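(* Let $q$ be a prime power, let $1\le k\le m$ be integers, and let $\mathcal{C}\subseteq\mathrm{Mat}(k\times m,\mathbb{F}_q)$ be a non-zero $\mathbb{F}_q$-linear code of dimension $1\le t\le km$. Then: (1) $a_1(\mathcal{C})=\mathrm{minrk}(\mathcal{C})$; (2) $a_t(\mathcal{C})\le k$; (3) for any $1\le r\le t-1$, $a_r(\mathcal{C})\le a_{r+1}(\mathcal{C})$; (4) for any $1\le r\le t-m$, $a_r(\mathcal{C})<a_{r+m}(\mathcal{C})$; (5) for any $1\le r\le t$, $a_r(\mathcal{C})\le k-\lfloor (t-r)/m\rfloor$; (6) for any $1\le r\le t$, $a_r(\mathcal{C})\ge \lceil r/m\rceil$.
   Context: For a Delsarte code (an $\mathbb{F}_q$-subspace) $\mathcal{C}\subseteq\mathrm{Mat}(k\times m,\mathbb{F}_q)$: $\mathrm{minrk}(\mathcal{C}):=\min\{\mathrm{rk}(M):M\in\mathcal{C},\ \mathrm{rk}(M)>0\}$ and $\mathrm{maxrk}(\mathcal{C}):=\max\{\mathrm{rk}(M):M\in\mathcal{C}\}$. One always has $\dim_{\mathbb{F}_q}(\mathcal{C})\le m\cdot\mathrm{maxrk}(\mathcal{C})$; $\mathcal{A}^D_q(k,m)$ is the set of Delsarte codes attaining equality (Delsarte optimal anticodes). For $1\le r\le \dim_{\mathbb{F}_q}(\mathcal{C})$, the $r$-th Delsarte generalized weight is $a_r(\mathcal{C}):=\frac1m\min\{\dim_{\mathbb{F}_q}(\mathcal{A}):\mathcal{A}\in\mathcal{A}^D_q(k,m),\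 \dim_{\mathbb{F}_q}(\mathcal{A}\cap\mathcal{C})\ge r\}$. *)

theory Defs
  imports "HOL-Analysis.Analysis"
begin

text \<open>Matrices in Mat(k x m, F) are elements of type F^'m^'k (k rows indexed by 'k,
  m columns indexed by 'm). F_q is an arbitrary finite field.  The F-vector space
  structure on matrices is entrywise scaling.\<close>

definition mscale :: "'a::field \<Rightarrow> 'a^'m^'k \<Rightarrow> 'a^'m^'k" where
  "mscale c M = (\<chi> i j. c * M $ i $ j)"

interpretation matsp: vector_space "mscale :: 'a::field \<Rightarrow> 'a^'m^'k \<Rightarrow> 'a^'m^'k"
  by unfold_locales (auto simp: mscale_def vec_eq_iff algebra_simps)

definition delsarte_code :: "('a::field^'m^'k) set \<Rightarrow> bool" where
  "delsarte_code C \<longleftrightarrow> matsp.subspace C"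

definition ddim :: "('a::field^'m^'k) set \<Rightarrow> nat" where
  "ddim C = matsp.dim C"

definition minrk :: "('a::field^'m^'k) set \<Rightarrow> nat" where
  "minrk C = Min {rank M | M. M \<in> C \<and> rank M > 0}"

definition maxrk :: "('a::field^'m^'k) set \<Rightarrow> nat" where
  "maxrk C = Max {rank M | M. M \<in> C}"

definition optimal_anticode :: "('a::field^'m::finite^'k) set \<Rightarrow> bool" where
  "optimal_anticode A \<longleftrightarrow> delsarte_code A \<and> ddim A = CARD('m) * maxrk A"

definition delsarte_weight :: "nat \<Rightarrow> ('a::field^'m::finite^'k) set \<Rightarrow> real" where
  "delsarte_weight r C =
     (1 / real CARD('m)) *
       real (Min {ddim A | A. optimal_anticode A \<and> ddim (A \<inter> C) \<ge> r})"

end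

theory Submission
  imports Defs
begin

text \<open>Parts (1), (2), (3) and (6) are read off from the fact that \<open>tens U W\<close>, the matrices with
  column space in \<open>U\<close> and row space in \<open>W\<close>, is an optimal anticode if \<open>W\<close> is the full space.
  Parts (4) and (5) need that an optimal anticode of maximal rank \<open>R > 0\<close> contains one of maximal
  rank \<open>R - 1\<close> whose intersection with a given subspace drops in dimension by at most \<open>m\<close>. This
  follows from the classification of optimal anticodes: they are \<open>tens U UNIV\<close> or, for square
  matrices, \<open>tens UNIV W\<close>.

  The bound \<open>dim A \<le> m R\<close> for a space \<open>A\<close> of matrices of rank at most \<open>R\<close> and its equality case
  are proved by induction on the number of rows. Take \<open>M \<in> A\<close> of maximal rank and \<open>e\<close> outside its
  column space. Every \<open>v\<close> with \<open>outer e v \<in> A\<close> lies in the row space of \<open>M\<close>, so there are at most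
  \<open>R\<close> dimensions of them. If \<open>v \<noteq> 0\<close> is one of them, eliminating the direction \<open>e\<close> from the columns
  and \<open>v\<close> from the rows lowers all ranks in \<open>A\<close> to at most \<open>R - 1\<close>. If there is none, eliminating
  \<open>e\<close> alone is injective on \<open>A\<close>. All steps work over every finite field, including the one with
  two elements.\<close>

section \<open>Dimension and cardinality over finite fields\<close>

lemma (in vector_space) card_span_independent:
  assumes "finite (UNIV :: 'b set)" "independent B"
  shows "card (span B) = CARD('a) ^ card B"
proof -
  have "finite B" by (rule finite_subset[OF subset_UNIV assms(1)])
  then show ?thesis using assms(2)
  proof (induction B rule: finite_induct)
    case empty
    show ?case by simp
  next
    case (insert b B)
    have ib: "independent B" and nb: "b \<notin> span B"
      using insert.prems insert.hyps by (auto simp: independent_insert)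
    let ?f = "\<lambda>(c, x). scale c b + x"
    have sp: "span (insert b B) = ?f ` (UNIV \<times> span B)"
    proof (intro equalityI subsetI)
      fix x assume "x \<in> span (insert b B)"
      then obtain c where "x - scale c b \<in> span B" by (auto simp: span_insert)
      then show "x \<in> ?f ` (UNIV \<times> span B)"
        by (auto intro!: image_eqI[of _ _ "(c, x - scale c b)"])
    next
      fix x assume "x \<in> ?f ` (UNIV \<times> span B)"
      then show "x \<in> span (insert b B)"
        by (auto intro!: span_add span_scale span_base[of b] intro: span_mono[THEN subsetD])
    qed
    have "inj_on ?f (UNIV \<times> span B)"
    proof (rule inj_onI, clarify)
      fix c x d y assume xy: "x \<in> span B" "y \<in> span B" and eq: "scale c b + x = scale d b + y"
      have "scale (c - d) b = y - x" using eq by (simp add: scale_left_diff_distrib algebra_simps)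
      then have m: "scale (c - d) b \<in> span B" using xy by (simp add: span_diff)
      have "c = d"
      proof (rule ccontr)
        assume "c \<noteq> d"
        then have "b = scale (inverse (c - d)) (scale (c - d) b)" by simp
        then show False using span_scale[OF m, of "inverse (c - d)"] nb by simp
      qed
      then show "c = d \<and> x = y" using eq by simp
    qed
    then have "card (span (insert b B)) = CARD('a) * card (span B)"
      unfolding sp by (simp add: card_image card_cartesian_product)
    then show ?case using insert.IH[OF ib] insert.hyps by simp
  qed
qed

text \<open>Over a finite field the number of elements of a subspace determines its dimension, so
  the dimension formulas below reduce to counting.\<close>

lemma (in vector_space) card_subspace:
  assumes "finite (UNIV :: 'b set)" "subspace S"
  shows "card S = CARD('a) ^ dim S"
proof -
  obtain B where B: "B \<subseteq> S" "independent B" "S \<subseteq> span B" "card B = dim S"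
    using basis_exists by blast
  then have "span B = S" using assms(2) span_minimal by blast
  then show ?thesis using card_span_independent[OF assms(1) B(2)] B(4) by simp
qed

lemma (in vector_space) dim_zero_space [simp]: "dim {0} = 0"
  using dim_span[of "{}"] dim_eq_card_independent[of "{}"] by (simp add: independent_empty)

lemma card_field_ge_2: "2 \<le> CARD('a::{field,finite})"
proof -
  have "card {0, 1 :: 'a} \<le> CARD('a)" by (intro card_mono) auto
  then show ?thesis by simp
qed

lemma (in vector_space) dim_mono_finite:
  assumes "finite (UNIV :: 'b set)" "S \<subseteq> T"
  shows "dim S \<le> dim T"
proof -
  obtain B where B: "B \<subseteq> S" "independent B" "S \<subseteq> span B" "card B = dim S"
    using basis_exists by blast
  obtain D where D: "D \<subseteq> T" "independent D" "T \<subseteq> span D" "card D = dim T"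
    using basis_exists by blast
  have "finite D" by (rule finite_subset[OF subset_UNIV assms(1)])
  then show ?thesis using independent_span_bound[of D B] B D assms(2) by auto
qed

lemma (in vector_space) subspace_eq_of_dim:
  assumes "finite (UNIV :: 'b set)" "subspace S" "subspace T" "S \<subseteq> T" "dim T \<le> dim S"
  shows "S = T"
proof -
  have "dim T = dim S" using dim_mono_finite assms by (simp add: le_antisym)
  then have "card S = card T" using card_subspace assms by simp
  then show ?thesis using assms(1,4) by (meson card_subset_eq finite_subset subset_UNIV)
qed

text \<open>Every nonempty fibre in \<open>S\<close> is a translate of the kernel in
  \<open>S\<close>.\<close>

lemma card_additive_image:
  fixes f :: "'b::{ab_group_add,finite} \<Rightarrow> 'c::ab_group_add"
  assumes add: "\<And>x y. f (x - y) = f x - f y" and S: "\<And>x y. x \<in> S \<Longrightarrow> y \<in> S \<Longrightarrow> x - y \<in> S"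
    and Sa: "\<And>x y. x \<in> S \<Longrightarrow> y \<in> S \<Longrightarrow> x + y \<in> S"
  shows "card S = card (f ` S) * card {x \<in> S. f x = 0}"
proof -
  have "card {x \<in> S. f x = y} = card {x \<in> S. f x = 0}" if y: "y \<in> f ` S" for y
  proof -
    obtain s where s: "s \<in> S" "y = f s" using y by blast
    have "bij_betw (\<lambda>x. x - s) {x \<in> S. f x = y} {x \<in> S. f x = 0}"
    proof (rule bij_betw_byWitness[of _ "\<lambda>x. x + s"])
      have "f (x + s) = f s" if "f x = 0" for x
        using add[of "x + s" s] that by simp
      then show "(\<lambda>x. x + s) ` {x \<in> S. f x = 0} \<subseteq> {x \<in> S. f x = y}"
        using s Sa by auto
    qed (use s S add in auto)
    then show ?thesis by (rule bij_betw_same_card)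
  qed
  then have "(\<Sum>y\<in>f ` S. card {x \<in> S. f x = y}) = card (f ` S) * card {x \<in> S. f x = 0}"
    by simp
  moreover have "(\<Sum>y\<in>f ` S. card {x \<in> S. f x = y}) = card S"
  proof -
    have "card (\<Union>y\<in>f ` S. {x \<in> S. f x = y}) = (\<Sum>y\<in>f ` S. card {x \<in> S. f x = y})"
      by (rule card_UN_disjoint) auto
    moreover have "(\<Union>y\<in>f ` S. {x \<in> S. f x = y}) = S" by auto
    ultimately show ?thesis by simp
  qed
  ultimately show ?thesis by simp
qed

text \<open>The fibre count, read as an identity between powers of the field size. The two scalings
  are parameters because matrices under \<open>mscale\<close> and vectors under \<open>*s\<close>
  both occur as domain and as range.\<close>

lemma rank_nullity:
  fixes s1 :: "'a::{field,finite} \<Rightarrow> 'b::{ab_group_add,finite} \<Rightarrow> 'b"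
    and s2 :: "'a \<Rightarrow> 'c::{ab_group_add,finite} \<Rightarrow> 'c"
  assumes lin: "Vector_Spaces.linear s1 s2 f" and S: "module.subspace s1 S"
  shows "vector_space.dim s1 S =
    vector_space.dim s2 (f ` S) + vector_space.dim s1 {x \<in> S. f x = 0}"
proof -
  interpret Vector_Spaces.linear s1 s2 f by fact
  have sk: "vs1.subspace {x \<in> S. f x = 0}"
    using S by (auto simp: vs1.subspace_def add scale)
  have si: "vs2.subspace (f ` S)" using S by (rule subspace_image)
  have "card S = card (f ` S) * card {x \<in> S. f x = 0}"
    by (rule card_additive_image) (auto simp: diff vs1.subspace_diff[OF S] vs1.subspace_add[OF S])
  then have "CARD('a) ^ vs1.dim S = CARD('a) ^ (vs2.dim (f ` S) + vs1.dim {x \<in> S. f x = 0})"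
    using vs1.card_subspace[OF _ S] vs1.card_subspace[OF _ sk] vs2.card_subspace[OF _ si]
    by (simp add: power_add)
  then show ?thesis using card_field_ge_2[where 'a='a] by (simp add: power_inject_exp)
qed

section \<open>Row and column spaces\<close>

definition vdot :: "'a::field^'n \<Rightarrow> 'a^'n \<Rightarrow> 'a" where
  "vdot x y = (\<Sum>i\<in>UNIV. x $ i * y $ i)"

definition outer :: "'a::field^'k \<Rightarrow> 'a^'m \<Rightarrow> 'a^'m^'k" where
  "outer e v = (\<chi> i j. e $ i * v $ j)"

definition rsp :: "'a::field^'m^'k \<Rightarrow> ('a^'m) set" where
  "rsp M = range (\<lambda>x. x v* M)"

definition csp :: "'a::field^'m^'k \<Rightarrow> ('a^'k) set" where
  "csp M = range (\<lambda>y. M *v y)"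

lemma vdot_simps:
  "vdot (x + y) e = vdot x e + vdot y e" "vdot (x - y) e = vdot x e - vdot y e"
  "vdot (c *s x) e = c * vdot x e" "vdot 0 e = 0" "vdot (axis i 1) e = e $ i"
  by (auto simp: vdot_def algebra_simps sum.distrib sum_subtractf sum_distrib_left axis_def
      if_distrib[of "\<lambda>z. z * _"] if_distrib[of "\<lambda>z. _ * z"] cong: if_cong)

lemma vmult_simps:
  fixes M :: "'a::field^'m^'k"
  shows "x v* outer e v = vdot x e *s v" "outer e v *v y = vdot v y *s e"
    "axis i 1 v* M = M $ i"
  by (auto simp: vec_eq_iff vector_matrix_mult_def matrix_vector_mult_def outer_def vdot_def
      sum_distrib_left sum_distrib_right axis_def if_distrib[of "\<lambda>z. z * _"]
      if_distrib[of "\<lambda>z. _ * z"] algebra_simps cong: if_cong)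

lemma linear_vmult: "Vector_Spaces.linear (*s) (*s) (\<lambda>x. x v* (M::'a::field^'m^'k))"
  using matrix_vector_mul_linear_gen[of "transpose M"] unfolding transpose_matrix_vector .

lemma subspace_rsp [simp]: "vec.subspace (rsp M)"
  unfolding rsp_def using linear_vmult[of M]
  by (metis module_hom.subspace_image module_hom_iff_linear vec.subspace_UNIV)

lemma rsp_transpose: "rsp (transpose M) = csp M" "csp (transpose M) = rsp M"
  by (auto simp: rsp_def csp_def)

lemma subspace_csp [simp]: "vec.subspace (csp M)"
  using subspace_rsp[of "transpose M"] by (simp add: rsp_transpose)

lemma rsp_eq_span_rows: "rsp M = vec.span (rows M)"
proof
  have "row i M \<in> rsp M" for i
    unfolding rsp_def by (rule range_eqI[of _ _ "axis i 1"]) (simp add: vmult_simps row_def vec_eq_iff)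
  then show "vec.span (rows M) \<subseteq> rsp M"
    by (intro vec.span_minimal) (auto simp: rows_def)
  have "x v* M = (\<Sum>i\<in>UNIV. x $ i *s row i M)" for x
    by (simp add: vec_eq_iff vector_matrix_mult_def row_def)
  then show "rsp M \<subseteq> vec.span (rows M)"
    unfolding rsp_def by (auto intro!: vec.span_sum intro: vec.span_scale vec.span_base simp: rows_def)
qed

lemma rank_rsp: "rank M = vec.dim (rsp M)"
  by (simp add: row_rank_def_gen rsp_eq_span_rows)

lemma row_in_rsp: "M $ i \<in> rsp M"
  unfolding rsp_def by (rule range_eqI[of _ _ "axis i 1"]) (simp add: vmult_simps)

text \<open>Expanding the rows in a basis \<open>B\<close> of the row space factors \<open>M\<close>
  through \<open>card B\<close> coordinates, and the coefficient vectors span a space containing all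
  columns. Applied to the transpose as well, this equates row and column rank.\<close>

lemma dim_csp_le: "vec.dim (csp M) \<le> vec.dim (rsp (M::'a::field^'m^'k))"
proof -
  obtain B where B: "B \<subseteq> rsp M" "vec.independent B" "rsp M \<subseteq> vec.span B" "card B = vec.dim (rsp M)"
    using vec.basis_exists by blast
  have fB: "finite B" using B(2) vec.finiteI_independent by blast
  have "\<exists>c. M $ i = (\<Sum>b\<in>B. c b *s b)" for i
    using B(3) row_in_rsp[of M i] vec.span_finite[OF fB] by (auto 0 3)
  then obtain c where c: "\<And>i. M $ i = (\<Sum>b\<in>B. c i b *s b)" by metis
  have "M *v y = (\<Sum>b\<in>B. vdot b y *s (\<chi> i. c i b))" for y
    by (simp add: vec_eq_iff matrix_vector_mult_def c vdot_def sum_component sum_distrib_left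
      sum_distrib_right sum.swap[of _ B] algebra_simps)
  then have "csp M \<subseteq> vec.span ((\<lambda>b. \<chi> i. c i b) ` B)"
    unfolding csp_def by (auto intro!: vec.span_sum intro: vec.span_scale vec.span_base)
  then have "vec.dim (csp M) \<le> card ((\<lambda>b. \<chi> i. c i b) ` B)"
    by (rule vec.dim_le_card) (use fB in simp)
  also have "\<dots> \<le> vec.dim (rsp M)" using card_image_le[OF fB] B(4) by metis
  finally show ?thesis .
qed

lemma rank_csp: "rank M = vec.dim (csp M)"
  using dim_csp_le[of M] dim_csp_le[of "transpose M"]
  by (simp add: rank_rsp rsp_transpose)

lemma rank_pos: "0 < rank M \<longleftrightarrow> M \<noteq> (0 :: 'a::field^'m^'k)"
proof -
  have "rank M = 0 \<longleftrightarrow> rsp M \<subseteq> {0}" by (simp add: rank_rsp)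
  also have "\<dots> \<longleftrightarrow> M = 0"
  proof
    assume "rsp M \<subseteq> {0}"
    then have "M $ i = 0" for i using row_in_rsp[of M i] by blast
    then show "M = 0" by (simp add: vec_eq_iff)
  qed (auto simp: rsp_def)
  finally show ?thesis by auto
qed

text \<open>Extend a basis of \<open>T\<close> together with \<open>e\<close> to a linear map that
  kills \<open>T\<close> and fixes \<open>e\<close>; one of its coordinates, scaled, is the
  functional.\<close>

lemma separating_functional:
  fixes T :: "('a::field^'n) set"
  assumes T: "vec.subspace T" and e: "e \<notin> T"
  obtains x where "\<And>t. t \<in> T \<Longrightarrow> vdot x t = 0" "vdot x e = 1"
proof -
  obtain B where B: "B \<subseteq> T" "vec.independent B" "T \<subseteq> vec.span B"
    by (rule vec.basis_exists[of T])
  have sB: "vec.span B = T" using B vec.span_minimal[OF B(1) T] by auto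
  have "vec.independent (insert e B)" using B(2) e sB by (simp add: vec.independent_insert)
  from vec.linear_independent_extend[OF this, of "\<lambda>x. if x = e then e else 0"]
  obtain g :: "'a^'n \<Rightarrow> 'a^'n" where g: "Vector_Spaces.linear (*s) (*s) g"
    and ge: "\<And>x. x \<in> insert e B \<Longrightarrow> g x = (if x = e then e else 0)" by blast
  have gB: "g b = 0" if "b \<in> B" for b using ge[of b] that e B(1) by auto
  have gT: "g t = 0" if "t \<in> T" for t
    using vec.linear_eq_0_on_span[OF g gB] that sB by blast
  have "e \<noteq> 0" using e T vec.subspace_0 by blast
  then obtain l where l: "e $ l \<noteq> 0" by (auto simp: vec_eq_iff)
  define x where "x = (\<chi> i. matrix g $ l $ i / e $ l)"
  have x: "vdot x t = g t $ l / e $ l" for t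
  proof -
    have "g t = matrix g *v t" using matrix_works[OF g] by simp
    then show ?thesis
      by (simp add: x_def vdot_def matrix_vector_mult_def sum_divide_distrib)
  qed
  show thesis
    by (rule that[of x]) (use gT ge[of e] l in \<open>auto simp: x\<close>)
qed

text \<open>A functional vanishing on the column space of \<open>M\<close> but not at \<open>e\<close> exhibits \<open>v\<close> in the
  row space of the sum.\<close>

lemma rank_add_outer:
  fixes M :: "'a::field^'m^'k"
  assumes e: "e \<notin> csp M" and v: "v \<notin> rsp M"
  shows "rank M + 1 \<le> rank (M + outer e v)" "rsp M \<subseteq> rsp (M + outer e v)"
proof -
  obtain x where x: "\<And>t. t \<in> csp M \<Longrightarrow> vdot x t = 0" "vdot x e = 1"
    using separating_functional[OF subspace_csp e] by metis
  have "x v* M = 0"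
  proof -
    have "(x v* M) $ j = 0" for j
    proof -
      have "column j M \<in> csp M"
        unfolding csp_def
        by (rule range_eqI[of _ _ "axis j 1"])
          (simp add: vec_eq_iff column_def matrix_vector_mult_def axis_def if_distrib[of "\<lambda>z. _ * z"] cong: if_cong)
      then show ?thesis using x(1)[of "column j M"]
        by (simp add: vdot_def column_def vector_matrix_mult_def)
    qed
    then show ?thesis by (simp add: vec_eq_iff)
  qed
  then have "x v* (M + outer e v) = v"
    by (simp add: vector_matrix_mult_add_rdistrib vmult_simps x)
  then have vin: "v \<in> rsp (M + outer e v)" unfolding rsp_def by (metis rangeI)
  have "y v* M \<in> rsp (M + outer e v)" for y
  proof -
    have "y v* M = y v* (M + outer e v) - vdot y e *s v"
      by (simp add: vector_matrix_mult_add_rdistrib vmult_simps)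
    moreover have "y v* (M + outer e v) \<in> rsp (M + outer e v)" by (simp add: rsp_def)
    ultimately show ?thesis using vin vec.subspace_diff vec.subspace_scale subspace_rsp by metis
  qed
  then show sub: "rsp M \<subseteq> rsp (M + outer e v)" by (auto simp: rsp_def[of M])
  have "vec.dim (insert v (rsp M)) = vec.dim (rsp M) + 1"
    using v by (simp add: vec.dim_insert vec.span_eq_iff[THEN iffD2])
  moreover have "vec.dim (insert v (rsp M)) \<le> vec.dim (rsp (M + outer e v))"
    by (rule vec.dim_subset) (use sub vin in auto)
  ultimately show "rank M + 1 \<le> rank (M + outer e v)" by (simp add: rank_rsp)
qed

section \<open>Elimination of a row and a column\<close>

text \<open>For \<open>e $ i \<noteq> 0\<close>, the projection along \<open>e\<close> onto the
  vectors with zero coordinate \<open>i\<close>. It models the quotient by \<open>e\<close> without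
  changing the type.\<close>

definition velim :: "'n \<Rightarrow> 'a::field^'n \<Rightarrow> 'a^'n \<Rightarrow> 'a^'n" where
  "velim i e x = x - (x $ i / e $ i) *s e"

text \<open>This is \<open>velim i e\<close> on every column. Written as subtraction of an outer
  product, it lets \<open>M\<close> be recovered by adding that product back.\<close>

definition relim :: "'k \<Rightarrow> 'a::field^'k \<Rightarrow> 'a^'m^'k \<Rightarrow> 'a^'m^'k" where
  "relim i e M = M - outer e ((1 / e $ i) *s M $ i)"

definition celim :: "'m \<Rightarrow> 'a::field^'m \<Rightarrow> 'a^'m^'k \<Rightarrow> 'a^'m^'k" where
  "celim j v M = (\<chi> a. velim j v (M $ a))"

lemma linear_velim: "Vector_Spaces.linear (*s) (*s) (velim i (e::'a::field^'n))"
  unfolding velim_def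
  by unfold_locales (auto simp: vec_eq_iff algebra_simps add_divide_distrib)

lemma linear_relim: "Vector_Spaces.linear mscale mscale (relim i (e::'a::field^'k))"
  unfolding relim_def
  by unfold_locales (auto simp: vec_eq_iff algebra_simps add_divide_distrib outer_def mscale_def)

lemma linear_celim: "Vector_Spaces.linear mscale mscale (celim j (v::'a::field^'m))"
  unfolding celim_def velim_def
  by unfold_locales (auto simp: vec_eq_iff algebra_simps add_divide_distrib outer_def mscale_def)

lemma linear_outer: "Vector_Spaces.linear (*s) mscale (outer (e::'a::field^'k) :: 'a^'m \<Rightarrow> _)"
  by unfold_locales (auto simp: vec_eq_iff algebra_simps outer_def mscale_def)

lemma linear_column: "Vector_Spaces.linear mscale (*s) (column j :: 'a::field^'m^'k \<Rightarrow> _)"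
  by unfold_locales (auto simp: vec_eq_iff algebra_simps column_def mscale_def)

lemma linear_row_nth: "Vector_Spaces.linear mscale (*s) (\<lambda>M :: 'a::field^'m^'k. M $ i)"
  by unfold_locales (auto simp: vec_eq_iff algebra_simps mscale_def)

lemma mult_relim:
  fixes M :: "'a::field^'m^'k"
  shows "relim i e M *v y = velim i e (M *v y)"
    "x v* relim i e M = x v* M - (vdot x e / e $ i) *s M $ i"
proof -
  have "vdot ((1 / e $ i) *s M $ i) y = (M *v y) $ i / e $ i"
    by (simp add: vdot_def matrix_vector_mult_def sum_divide_distrib)
  then show "relim i e M *v y = velim i e (M *v y)"
    by (simp add: relim_def velim_def matrix_vector_mult_diff_rdistrib vmult_simps)
  show "x v* relim i e M = x v* M - (vdot x e / e $ i) *s M $ i"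
    by (simp add: relim_def vector_matrix_mult_diff_rdistrib vmult_simps)
qed

lemma vmult_celim:
  fixes M :: "'a::field^'m^'k"
  shows "x v* celim j v M = velim j v (x v* M)"
  by (simp add: celim_def velim_def vec_eq_iff vector_matrix_mult_def right_diff_distrib
      sum_subtractf sum_divide_distrib sum_distrib_right mult.assoc)

lemma velim_nth [simp]: "e $ i \<noteq> 0 \<Longrightarrow> velim i e x $ i = 0"
  by (simp add: velim_def)

lemma velim_in: "vec.subspace U \<Longrightarrow> e \<in> U \<Longrightarrow> x \<in> U \<Longrightarrow> velim i e x \<in> U"
  by (simp add: velim_def vec.subspace_diff vec.subspace_scale)

lemma subspace_velim: "vec.subspace U \<Longrightarrow> vec.subspace (velim i e ` U)"
  using linear_velim by (metis module_hom.subspace_image module_hom_iff_linear)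

lemma dim_line: "e \<noteq> 0 \<Longrightarrow> vec.dim (range (\<lambda>c. c *s e)) = 1"
  using vec.dim_span[of "{e}"] by (simp add: vec.span_singleton)

lemma dim_velim:
  fixes U :: "('a::{field,finite}^'n) set"
  assumes U: "vec.subspace U" and e: "e \<in> U" "e $ i \<noteq> 0"
  shows "vec.dim U = Suc (vec.dim (velim i e ` U))"
proof -
  have "e \<noteq> 0" using e(2) by auto
  have "{x \<in> U. velim i e x = 0} = range (\<lambda>c. c *s e)"
  proof
    show "{x \<in> U. velim i e x = 0} \<subseteq> range (\<lambda>c. c *s e)"
      by (auto simp: velim_def)
    show "range (\<lambda>c. c *s e) \<subseteq> {x \<in> U. velim i e x = 0}"
      using e U by (auto simp: velim_def vec.subspace_scale)
  qed
  then show ?thesis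
    using rank_nullity[OF linear_velim[of i e] U] dim_line[OF \<open>e \<noteq> 0\<close>] by simp
qed

text \<open>The rows \<open>x v* M\<close> with \<open>x\<close> orthogonal to \<open>e\<close> form a space \<open>S\<close> common to \<open>M\<close> and
  \<open>M + outer e v\<close>. If \<open>v \<notin> S\<close>, the two \<open>i\<close>-th rows differ by a non-zero multiple of \<open>v\<close>, so
  they are not both in \<open>S\<close>.\<close>

lemma rank_eliminate:
  fixes M :: "'a::{field,finite}^'m^'k"
  assumes e: "e $ i \<noteq> 0" and v: "v $ j \<noteq> 0"
  shows "rank (celim j v (relim i e M)) + 1 \<le> max (rank M) (rank (M + outer e v))"
proof -
  define X where "X = {x. vdot x e = 0}"
  define S where "S = (\<lambda>x. x v* M) ` X"
  have X: "vec.subspace X" by (auto simp: X_def vec.subspace_def vdot_simps)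
  have S: "vec.subspace S"
    unfolding S_def using X linear_vmult[of M]
    by (metis module_hom.subspace_image module_hom_iff_linear)
  have SM: "S \<subseteq> rsp M" by (auto simp: S_def rsp_def)
  have SM': "S \<subseteq> rsp (M + outer e v)"
  proof
    fix s assume "s \<in> S"
    then obtain x where "vdot x e = 0" "s = x v* M" by (auto simp: S_def X_def)
    then have "s = x v* (M + outer e v)"
      by (simp add: vector_matrix_mult_add_rdistrib vmult_simps)
    then show "s \<in> rsp (M + outer e v)" by (simp add: rsp_def)
  qed
  have "rsp (celim j v (relim i e M)) \<subseteq> velim j v ` S"
  proof
    fix y assume "y \<in> rsp (celim j v (relim i e M))"
    then obtain x where x: "y = velim j v (x v* M - (vdot x e / e $ i) *s M $ i)"
      by (auto simp: rsp_def vmult_celim mult_relim)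
    \<comment> \<open>Subtracting this multiple of the \<open>i\<close>-th unit vector makes
      \<open>x\<close> orthogonal to \<open>e\<close>; in the product it subtracts the same multiple
      of row \<open>i\<close>.\<close>
    let ?x = "x - (vdot x e / e $ i) *s axis i 1"
    have "?x \<in> X" using e by (simp add: X_def vdot_simps)
    moreover have "?x v* M = x v* M - (vdot x e / e $ i) *s M $ i"
      by (simp only: vector_matrix_mult_diff_distrib scalar_vector_matrix_assoc vmult_simps)
    ultimately show "y \<in> velim j v ` S" unfolding x S_def by (metis imageI)
  qed
  then have N: "rank (celim j v (relim i e M)) \<le> vec.dim (velim j v ` S)"
    unfolding rank_rsp by (rule vec.dim_subset)
  show ?thesis
  proof (cases "v \<in> S")
    case True
    have "vec.dim S \<le> rank M" unfolding rank_rsp using SM by (rule vec.dim_subset)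
    then show ?thesis using N dim_velim[OF S True v] by simp
  next
    case False
    have le: "vec.dim (velim j v ` S) \<le> vec.dim S"
      by (rule vec.dim_image_le[OF linear_velim])
    have grow: "vec.dim S + 1 \<le> vec.dim T" if "a \<notin> S" "a \<in> T" "S \<subseteq> T" for a T
    proof -
      have "vec.dim (insert a S) = vec.dim S + 1"
        using that S by (simp add: vec.dim_insert vec.span_eq_iff[THEN iffD2])
      moreover have "vec.dim (insert a S) \<le> vec.dim T"
        by (rule vec.dim_subset) (use that in auto)
      ultimately show ?thesis by simp
    qed
    show ?thesis
    proof (cases "M $ i \<in> S")
      case True
      have "(M + outer e v) $ i \<notin> S"
      proof
        assume "(M + outer e v) $ i \<in> S"
        then have "(M + outer e v) $ i - M $ i \<in> S" using True S vec.subspace_diff by blast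
        moreover have "(M + outer e v) $ i - M $ i = e $ i *s v"
          by (simp add: vec_eq_iff outer_def)
        ultimately have "(1 / e $ i) *s (e $ i *s v) \<in> S" using S vec.subspace_scale by metis
        then show False using e False by simp
      qed
      from grow[OF this row_in_rsp SM'] show ?thesis using N le by (simp add: rank_rsp)
    next
      case False
      from grow[OF this row_in_rsp SM] show ?thesis using N le by (simp add: rank_rsp)
    qed
  qed
qed

lemma rank_relim_le: "rank (relim i e M) \<le> rank (M :: 'a::field^'m^'k)"
proof -
  have "csp (relim i e M) = velim i e ` csp M"
    by (auto simp: csp_def mult_relim)
  then show ?thesis unfolding rank_csp
    by (simp add: vec.dim_image_le[OF linear_velim])
qed

section \<open>Matrices with prescribed row and column spaces\<close>

definition tens :: "('a::field^'k) set \<Rightarrow> ('a^'m) set \<Rightarrow> ('a^'m^'k) set" where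
  "tens U W = {M. csp M \<subseteq> U \<and> rsp M \<subseteq> W}"

text \<open>For \<open>e $ i \<noteq> 0\<close> the embedding \<open>outer e\<close> identifies this
  with the kernel of \<open>relim i e\<close> on \<open>A\<close>.\<close>

definition slice :: "'a::field^'k \<Rightarrow> ('a^'m^'k) set \<Rightarrow> ('a^'m) set" where
  "slice e A = {v. outer e v \<in> A}"

lemma mult_mscale:
  fixes M :: "'a::field^'m^'k"
  shows "mscale c M *v y = c *s (M *v y)" "x v* mscale c M = c *s (x v* M)"
  by (auto simp: vec_eq_iff mscale_def matrix_vector_mult_def vector_matrix_mult_def
      sum_distrib_left algebra_simps)

lemma subspace_tens [simp]:
  assumes "vec.subspace U" "vec.subspace W"
  shows "matsp.subspace (tens U W)"
  using assms
  by (auto simp: matsp.subspace_def tens_def csp_def rsp_def mult_mscale vec.subspace_0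
      matrix_vector_mult_add_rdistrib vector_matrix_mult_add_rdistrib
      intro!: vec.subspace_add vec.subspace_scale)

lemma outer_in_tens:
  "vec.subspace U \<Longrightarrow> vec.subspace W \<Longrightarrow> u \<in> U \<Longrightarrow> w \<in> W \<Longrightarrow> outer u w \<in> tens U W"
  by (auto simp: tens_def csp_def rsp_def vmult_simps intro!: vec.subspace_scale)

lemma subspace_slice: "matsp.subspace A \<Longrightarrow> vec.subspace (slice e A)"
  unfolding slice_def using linear_outer[of e]
  by (metis (no_types) module_hom.subspace_vimage module_hom_iff_linear vimage_def)

lemma outer_eq_0: "outer e v = 0 \<Longrightarrow> e \<noteq> 0 \<Longrightarrow> v = (0 :: 'a::field^'m)"
  by (auto simp: vec_eq_iff outer_def)

lemma outer_0_right: "outer e (0 :: 'a::field^'m) = 0"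
  by (simp add: outer_def vec_eq_iff)

lemma dim_slice:
  fixes A :: "('a::{field,finite}^'m^'k) set"
  assumes A: "matsp.subspace A" and e: "e $ i \<noteq> 0"
  shows "matsp.dim A = matsp.dim (relim i e ` A) + vec.dim (slice e A)"
proof -
  have e0: "e \<noteq> 0" using e by auto
  have "{M \<in> A. relim i e M = 0} = outer e ` slice e A"
  proof
    show "{M \<in> A. relim i e M = 0} \<subseteq> outer e ` slice e A"
      by (auto simp: relim_def slice_def)
    have "relim i e (outer e v) = 0" for v :: "'a^'m"
      using e by (simp add: relim_def outer_def vec_eq_iff)
    then show "outer e ` slice e A \<subseteq> {M \<in> A. relim i e M = 0}"
      by (auto simp: slice_def)
  qed
  moreover have "{v \<in> slice e A. outer e v = 0} = {0}"
    using outer_eq_0[OF _ e0] vec.subspace_0[OF subspace_slice[OF A], of e]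
    by (auto simp: outer_0_right)
  then have "vec.dim (slice e A) = matsp.dim (outer e ` slice e A)"
    using rank_nullity[OF linear_outer subspace_slice[OF A], of e e] by simp
  ultimately show ?thesis using rank_nullity[OF linear_relim A, of i e] by simp
qed

lemma relim_in_tens:
  assumes "M \<in> tens U W" "vec.subspace W"
  shows "relim i e M \<in> tens (velim i e ` U) W"
proof -
  have "M $ i \<in> W" using assms row_in_rsp[of M i] by (auto simp: tens_def)
  then show ?thesis using assms
    by (auto simp: tens_def csp_def rsp_def mult_relim intro!: vec.subspace_diff vec.subspace_scale)
qed

lemma celim_in_tens:
  assumes "M \<in> tens U W" "vec.subspace U"
  shows "celim j v M \<in> tens U (velim j v ` W)"
proof -
  have "celim j v M = transpose (relim j v (transpose M))"
    by (simp add: celim_def relim_def velim_def outer_def transpose_def vec_eq_iff)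
  moreover have "transpose M \<in> tens W U" using assms by (simp add: tens_def rsp_transpose)
  ultimately show ?thesis
    using relim_in_tens[of "transpose M" W U j v] assms(2) by (simp add: tens_def rsp_transpose)
qed

lemma tens_mono: "U \<subseteq> U' \<Longrightarrow> W \<subseteq> W' \<Longrightarrow> tens U W \<subseteq> tens U' W'"
  by (auto simp: tens_def)

lemma slice_tens_subset:
  assumes "vec.subspace W" "A \<subseteq> tens U W" "e \<noteq> (0 :: 'a::field^'k)"
  shows "slice e A \<subseteq> W"
proof
  fix v assume v: "v \<in> slice e A"
  obtain i where i: "e $ i \<noteq> 0" using assms(3) by (auto simp: vec_eq_iff)
  have "outer e v $ i \<in> W"
    using v assms(2) row_in_rsp[of "outer e v" i] by (auto simp: slice_def tens_def)
  then have "(1 / e $ i) *s outer e v $ i \<in> W" using assms(1) vec.subspace_scale by blast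
  moreover have "(1 / e $ i) *s outer e v $ i = v" using i by (simp add: outer_def vec_eq_iff)
  ultimately show "v \<in> W" by simp
qed

text \<open>Induction on the dimension of \<open>U\<close>: eliminating a direction \<open>e\<close>
  of \<open>U\<close> leaves the tensor space over a smaller \<open>U\<close>, and the slice at
  \<open>e\<close> is all of \<open>W\<close>.\<close>

lemma dim_tens:
  fixes U :: "('a::{field,finite}^'k) set" and W :: "('a^'m) set"
  assumes "vec.subspace U" "vec.subspace W"
  shows "matsp.dim (tens U W) = vec.dim U * vec.dim W"
  using assms(1)
proof (induction "vec.dim U" arbitrary: U)
  case 0
  have "tens U W \<subseteq> {0}"
  proof
    fix M assume "M \<in> tens U W"
    then have "csp M \<subseteq> {0}" using 0 by (auto simp: tens_def)
    then have "rank M = 0" by (simp add: rank_csp)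
    then show "M \<in> {0}" using rank_pos[of M] by simp
  qed
  then have "tens U W = {0}" using matsp.subspace_0[OF subspace_tens[OF 0(2) assms(2)]] by blast
  then have "matsp.dim (tens U W) = 0" by simp
  then show ?case using 0 by simp
next
  case (Suc n)
  have "\<not> U \<subseteq> {0}" using Suc(2) by (metis Zero_not_Suc vec.dim_eq_0)
  then obtain e i where e: "e \<in> U" "e $ i \<noteq> 0" by (force simp: vec_eq_iff)
  let ?U = "velim i e ` U"
  have dU: "vec.dim U = Suc (vec.dim ?U)" using dim_velim[OF Suc(3) e] .
  have "relim i e ` tens U W = tens ?U W"
  proof
    show "relim i e ` tens U W \<subseteq> tens ?U W" using relim_in_tens assms(2) by auto
    show "tens ?U W \<subseteq> relim i e ` tens U W"
    proof
      fix N assume N: "N \<in> tens ?U W"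
      then have "N \<in> tens U W" using tens_mono[of ?U U W W] velim_in[OF Suc(3) e(1)] by blast
      \<comment> \<open>The columns of \<open>N\<close> lie in the eliminated space, so row
        \<open>i\<close> vanishes and \<open>N\<close> is its own preimage.\<close>
      moreover have "N $ i = 0"
      proof -
        have "N *v axis b 1 \<in> ?U" for b using N by (auto simp: tens_def csp_def)
        then have "(N *v axis b 1) $ i = 0" for b
        proof -
          obtain x where "N *v axis b 1 = velim i e x"
            using \<open>\<And>b. N *v axis b 1 \<in> ?U\<close> by blast
          then show ?thesis using e(2) by simp
        qed
        then have "N $ i $ b = 0" for b
          by (simp add: matrix_vector_mult_def axis_def if_distrib[of "\<lambda>z. _ * z"] cong: if_cong)
        then show ?thesis by (simp add: vec_eq_iff)
      qed
      then have "relim i e N = N" by (simp add: relim_def outer_def vec_eq_iff)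
      ultimately show "N \<in> relim i e ` tens U W" by (metis imageI)
    qed
  qed
  moreover have "slice e (tens U W) = W"
  proof
    show "W \<subseteq> slice e (tens U W)"
      using outer_in_tens[OF Suc(3) assms(2) e(1)] by (auto simp: slice_def)
    show "slice e (tens U W) \<subseteq> W"
      by (rule slice_tens_subset[OF assms(2) order_refl]) (use e(2) in auto)
  qed
  moreover have "matsp.dim (tens ?U W) = vec.dim ?U * vec.dim W"
    using Suc(1)[of ?U] Suc(2) dU subspace_velim[OF Suc(3)] by simp
  ultimately show ?case
    using dim_slice[OF subspace_tens[OF Suc(3) assms(2)] e(2)] dU by simp
qed

text \<open>Outer products generate: a matrix is its elimination plus one outer product with
  \<open>e\<close>, and the elimination has its columns in a smaller space.\<close>

lemma tens_subsetI:
  fixes U :: "('a::{field,finite}^'k) set" and W :: "('a^'m) set"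
  assumes "vec.subspace U" "vec.subspace W" "matsp.subspace A"
    and "\<And>u w. u \<in> U \<Longrightarrow> w \<in> W \<Longrightarrow> outer u w \<in> A"
  shows "tens U W \<subseteq> A"
  using assms(1,4)
proof (induction "vec.dim U" arbitrary: U)
  case 0
  have "M = 0" if "M \<in> tens U W" for M
  proof -
    have "csp M \<subseteq> {0}" using 0 that by (auto simp: tens_def)
    then have "rank M = 0" by (simp add: rank_csp)
    then show ?thesis using rank_pos[of M] by simp
  qed
  then show ?case using matsp.subspace_0[OF assms(3)] by blast
next
  case (Suc n)
  have "\<not> U \<subseteq> {0}" using Suc(2) by (metis Zero_not_Suc vec.dim_eq_0)
  then obtain e i where e: "e \<in> U" "e $ i \<noteq> 0" by (force simp: vec_eq_iff)
  let ?U = "velim i e ` U"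
  have sub: "?U \<subseteq> U" using velim_in[OF Suc(3) e(1)] by blast
  have IH: "tens ?U W \<subseteq> A"
    using Suc(1)[of ?U] Suc(2) dim_velim[OF Suc(3) e] subspace_velim[OF Suc(3)] sub Suc(4)
    by (simp add: subset_iff)
  show ?case
  proof
    fix M assume M: "M \<in> tens U W"
    have "M $ i \<in> W" using M row_in_rsp[of M i] by (auto simp: tens_def)
    then have "outer e ((1 / e $ i) *s M $ i) \<in> A"
      using Suc(4) e(1) assms(2) vec.subspace_scale by blast
    moreover have "relim i e M \<in> A" using relim_in_tens[OF M assms(2)] IH by blast
    ultimately have "relim i e M + outer e ((1 / e $ i) *s M $ i) \<in> A"
      using assms(3) matsp.subspace_add by blast
    then show "M \<in> A" by (simp add: relim_def)
  qed
qed

text \<open>Eliminating \<open>e\<close> costs the slice. Eliminating \<open>v\<close> afterwards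
  costs the matrices whose rows are all multiples of \<open>v\<close>; these are determined by
  column \<open>j\<close>, which lies in the image of \<open>U\<close> under
  \<open>velim i e\<close>, of dimension one below that of \<open>U\<close>. Hence the strict
  inequality.\<close>

lemma dim_le_slice:
  fixes A :: "('a::{field,finite}^'m^'k) set"
  assumes A: "matsp.subspace A" "A \<subseteq> tens U W" and U: "vec.subspace U" and W: "vec.subspace W"
    and e: "e \<in> U" "e $ i \<noteq> 0" and v: "v $ j \<noteq> 0"
  shows "matsp.dim A < vec.dim (slice e A) + vec.dim U
    + matsp.dim ((\<lambda>M. celim j v (relim i e M)) ` A)"
proof -
  let ?P = "relim i e ` A"
  have P: "matsp.subspace ?P"
    using A(1) linear_relim[of i e] by (metis module_hom.subspace_image module_hom_iff_linear)
  define K where "K = {N \<in> ?P. celim j v N = 0}"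
  have K: "matsp.subspace K"
  proof -
    interpret C: Vector_Spaces.linear mscale mscale "celim j v :: 'a^'m^'k \<Rightarrow> _" by (rule linear_celim)
    have "K = ?P \<inter> {N. celim j v N = 0}" by (auto simp: K_def)
    then show ?thesis using matsp.subspace_inter[OF P C.subspace_kernel] by simp
  qed
  have "{N \<in> K. column j N = 0} = {0}"
  proof -
    have "N = 0" if "N \<in> K" "column j N = 0" for N
    proof -
      have "N $ a $ b = celim j v N $ a $ b + N $ a $ j / v $ j * v $ b" for a b
        by (simp add: celim_def velim_def)
      moreover have "N $ a $ j = 0" for a using that(2) by (simp add: column_def vec_eq_iff)
      ultimately show ?thesis using that(1) by (simp add: K_def vec_eq_iff)
    qed
    moreover have "0 \<in> K" using K matsp.subspace_0 by blast
    moreover have "column j (0 :: 'a^'m^'k) = 0" by (simp add: column_def vec_eq_iff)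
    ultimately show ?thesis by blast
  qed
  then have "matsp.dim K = vec.dim (column j ` K)"
    using rank_nullity[OF linear_column K, of j] by simp
  also have "\<dots> \<le> vec.dim (velim i e ` U)"
  proof (rule vec.dim_subset)
    show "column j ` K \<subseteq> velim i e ` U"
    proof clarify
      fix N assume "N \<in> K"
      then have "N \<in> tens (velim i e ` U) W" using relim_in_tens[OF _ W] A(2) unfolding K_def by blast
      moreover have "column j N = N *v axis j 1"
        by (simp add: vec_eq_iff column_def matrix_vector_mult_def axis_def if_distrib[of "\<lambda>z. _ * z"] cong: if_cong)
      ultimately show "column j N \<in> velim i e ` U" by (auto simp: tens_def csp_def)
    qed
  qed
  also have "\<dots> < vec.dim U" using dim_velim[OF U e] by simp
  finally have "matsp.dim K < vec.dim U" .
  then show ?thesis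
    using dim_slice[OF A(1) e(2)] rank_nullity[OF linear_celim P, of j v]
    by (simp add: K_def image_image)
qed

text \<open>For \<open>v\<close> outside the row space, \<open>M + outer e v\<close> would lie in
  \<open>A\<close> with rank above the maximum.\<close>

lemma slice_subset_rsp:
  fixes A :: "('a::field^'m^'k) set"
  assumes A: "matsp.subspace A" and M: "M \<in> A" "\<And>N. N \<in> A \<Longrightarrow> rank N \<le> rank M"
    and e: "e \<notin> csp M"
  shows "slice e A \<subseteq> rsp M"
proof
  fix v assume v: "v \<in> slice e A"
  show "v \<in> rsp M"
  proof (rule ccontr)
    assume "v \<notin> rsp M"
    then have "rank M + 1 \<le> rank (M + outer e v)" using rank_add_outer e by blast
    moreover have "M + outer e v \<in> A" using v M(1) A matsp.subspace_add by (auto simp: slice_def)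
    ultimately show False using M(2) by fastforce
  qed
qed

section \<open>Spaces of matrices of bounded rank\<close>

lemma max_rank_element:
  fixes A :: "('a::{field,finite}^'m^'k) set"
  assumes "B \<in> A"
  obtains M where "M \<in> A" "\<And>N. N \<in> A \<Longrightarrow> rank N \<le> rank M"
proof -
  have "Max (rank ` A) \<in> rank ` A" by (rule Max_in) (use assms in auto)
  then obtain M where "M \<in> A" "Max (rank ` A) = rank M" by (rule imageE)
  moreover have "rank N \<le> Max (rank ` A)" if "N \<in> A" for N
    using that by simp
  ultimately show thesis using that by simp
qed

text \<open>With each \<open>M\<close> also \<open>M + outer e v\<close> lies in \<open>A\<close>,
  so \<open>rank_eliminate\<close> lowers every rank. The last conclusion avoids subtraction and
  thereby also yields \<open>1 \<le> R\<close>.\<close>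

lemma eliminate_space:
  fixes A :: "('a::{field,finite}^'m^'k) set"
  assumes A: "matsp.subspace A" "A \<subseteq> tens U W" and U: "vec.subspace U" and W: "vec.subspace W"
    and i: "e $ i \<noteq> 0" and v: "outer e v \<in> A" "v $ j \<noteq> 0"
    and rk: "\<forall>M\<in>A. rank M \<le> R"
  defines "B \<equiv> (\<lambda>M. celim j v (relim i e M)) ` A"
  shows "matsp.subspace B" "B \<subseteq> tens (velim i e ` U) (velim j v ` W)"
    "\<And>N. N \<in> B \<Longrightarrow> rank N + 1 \<le> R"
proof -
  have linr: "module_hom mscale mscale (relim i e :: 'a^'m^'k \<Rightarrow> _)"
    unfolding module_hom_iff_linear by (rule linear_relim)
  have linc: "module_hom mscale mscale (celim j v :: 'a^'m^'k \<Rightarrow> _)"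
    unfolding module_hom_iff_linear by (rule linear_celim)
  show "matsp.subspace B"
    using module_hom.subspace_image[OF linc module_hom.subspace_image[OF linr A(1)]]
    by (simp add: image_image B_def)
  show "B \<subseteq> tens (velim i e ` U) (velim j v ` W)"
    unfolding B_def
  proof clarify
    fix N assume "N \<in> A"
    then have "N \<in> tens U W" using A(2) by blast
    then show "celim j v (relim i e N) \<in> tens (velim i e ` U) (velim j v ` W)"
      by (intro celim_in_tens[OF relim_in_tens[OF _ W] subspace_velim[OF U]])
  qed
  have "rank (celim j v (relim i e N)) + 1 \<le> R" if "N \<in> A" for N
    using rank_eliminate[OF i v(2), of N] bspec[OF rk that]
      bspec[OF rk matsp.subspace_add[OF A(1) that v(1)]]
    by simp
  then show "\<And>N. N \<in> B \<Longrightarrow> rank N + 1 \<le> R" by (auto simp: B_def)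
qed

text \<open>The ambient spaces \<open>U\<close> and \<open>W\<close> are arbitrary so that
  elimination can shrink them while the matrix type stays fixed.\<close>

lemma dim_le_of_rank_le:
  fixes A :: "('a::{field,finite}^'m^'k) set"
  assumes "matsp.subspace A" "A \<subseteq> tens U W" "vec.subspace U" "vec.subspace W"
    and "vec.dim U \<le> vec.dim W" "\<And>M. M \<in> A \<Longrightarrow> rank M \<le> R"
  shows "matsp.dim A \<le> vec.dim W * R"
  using assms
proof (induction "vec.dim U" arbitrary: U W A R rule: less_induct)
  case less
  note A = less(2,3) and U = less(4) and W = less(5) and rk = less(7)
  show ?case
  proof (cases "vec.dim U \<le> R")
    case True
    have "matsp.dim A \<le> matsp.dim (tens U W)" by (rule matsp.dim_mono_finite) (use A in auto)
    also have "\<dots> = vec.dim W * vec.dim U" using dim_tens[OF U W] by simp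
    also have "\<dots> \<le> vec.dim W * R" using True by simp
    finally show ?thesis .
  next
    case False
    obtain M where M: "M \<in> A" "\<And>N. N \<in> A \<Longrightarrow> rank N \<le> rank M"
      using max_rank_element[OF matsp.subspace_0[OF A(1)]] by metis
    have "vec.dim (csp M) < vec.dim U" using False rk[OF M(1)] by (simp add: rank_csp)
    then obtain e where e: "e \<in> U" "e \<notin> csp M" using vec.dim_subset leD by blast
    then have "e \<noteq> 0" using vec.subspace_0[OF subspace_csp] by blast
    then obtain i where i: "e $ i \<noteq> 0" by (auto simp: vec_eq_iff)
    let ?U = "velim i e ` U"
    have dU: "vec.dim U = Suc (vec.dim ?U)" using dim_velim[OF U e(1) i] .
    have sU: "vec.subspace ?U" using subspace_velim[OF U] .
    have linr: "module_hom mscale mscale (relim i e :: 'a^'m^'k \<Rightarrow> _)"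
      unfolding module_hom_iff_linear by (rule linear_relim)
    have sP: "matsp.subspace (relim i e ` A)" by (rule module_hom.subspace_image[OF linr A(1)])
    show ?thesis
    proof (cases "slice e A \<subseteq> {0}")
      case True
      then have "matsp.dim A = matsp.dim (relim i e ` A)" using dim_slice[OF A(1) i] by simp
      also have "\<dots> \<le> vec.dim W * R"
      proof (rule less(1)[OF _ sP _ sU W])
        show "relim i e ` A \<subseteq> tens ?U W" using A(2) relim_in_tens[OF _ W] by blast
        show "rank N \<le> R" if "N \<in> relim i e ` A" for N
          using that rk rank_relim_le le_trans by blast
      qed (use dU less(6) in auto)
      finally show ?thesis .
    next
      case False
      then obtain v where "v \<in> slice e A" "v \<noteq> 0" by blast
      moreover from this obtain j where "v $ j \<noteq> 0" by (auto simp: vec_eq_iff)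
      ultimately have v: "outer e v \<in> A" "v $ j \<noteq> 0" by (auto simp: slice_def)
      have "v \<in> W"
        using slice_tens_subset[OF W A(2) \<open>e \<noteq> 0\<close>] v(1) by (auto simp: slice_def)
      let ?W = "velim j v ` W" and ?A = "(\<lambda>M. celim j v (relim i e M)) ` A"
      have dW: "vec.dim W = Suc (vec.dim ?W)" using dim_velim[OF W \<open>v \<in> W\<close> v(2)] .
      have "\<forall>M\<in>A. rank M \<le> R" using rk by blast
      note B = eliminate_space[OF A U W i v this]
      have "matsp.dim ?A \<le> vec.dim ?W * (R - 1)"
      proof (rule less(1)[OF _ B(1,2) sU subspace_velim[OF W]])
        show "rank N \<le> R - 1" if "N \<in> ?A" for N
          using B(3)[OF that] by simp
      qed (use dU dW less(6) in auto)
      moreover have "vec.dim (slice e A) \<le> R"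
        using vec.dim_subset[OF slice_subset_rsp[OF A(1) M e(2)]] rk[OF M(1)] rank_rsp[of M] by simp
      moreover have "matsp.dim A < vec.dim (slice e A) + vec.dim U + matsp.dim ?A"
        by (rule dim_le_slice[OF A U W e(1) i v(2)])
      \<comment> \<open>The right side equals \<open>vec.dim W * R + 1\<close> once
        \<open>1 \<le> R\<close>, so strictness leaves exactly the claim.\<close>
      ultimately have "matsp.dim A < R + vec.dim W + vec.dim ?W * (R - 1)" using less(6) by linarith
      moreover have "1 \<le> R" using B(3)[OF imageI[OF M(1)]] by simp
      ultimately show ?thesis by (cases R) (auto simp: dW algebra_simps)
    qed
  qed
qed

section \<open>Row spaces that contain one vector and avoid another\<close>

lemma rsp_add_outer_subset: "rsp (M + outer e v) \<subseteq> vec.span (insert v (rsp M))"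
proof
  fix y assume "y \<in> rsp (M + outer e v)"
  then obtain x where "y = x v* M + vdot x e *s v"
    by (auto simp: rsp_def vector_matrix_mult_add_rdistrib vmult_simps)
  moreover have "x v* M \<in> vec.span (insert v (rsp M))"
    by (rule vec.span_base) (simp add: rsp_def)
  moreover have "vdot x e *s v \<in> vec.span (insert v (rsp M))"
    by (intro vec.span_scale vec.span_base) simp
  ultimately show "y \<in> vec.span (insert v (rsp M))" by (simp add: vec.span_add)
qed

text \<open>The exchange property; it keeps \<open>y\<close> outside a row space that grows by
  \<open>z\<close>.\<close>

lemma not_in_span_insert_swap:
  assumes "vec.subspace S" "y \<notin> S" "z \<notin> vec.span (insert y S)"
  shows "y \<notin> vec.span (insert z S)"
proof
  assume "y \<in> vec.span (insert z S)"
  moreover have "y \<notin> vec.span S" using assms(1,2) by (simp add: vec.span_eq_iff[THEN iffD2])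
  ultimately show False using vec.in_span_insert assms(3) by blast
qed

lemma exists_outside_span_insert:
  assumes "vec.subspace S" "vec.dim S + 1 < vec.dim (W :: ('a::field^'m) set)"
  obtains z where "z \<in> W" "z \<notin> vec.span (insert y S)"
proof -
  have "vec.dim (vec.span (insert y S)) \<le> vec.dim S + 1" by (simp add: vec.dim_insert)
  then have "\<not> W \<subseteq> vec.span (insert y S)"
    using vec.dim_subset[of W "vec.span (insert y S)"] assms(2) by linarith
  then show thesis using that by blast
qed

text \<open>Start with \<open>outer u w\<close> and raise the rank one at a time by
  \<open>outer u z\<close>. Choosing \<open>z\<close> outside the span of \<open>y\<close> and the
  current row space keeps \<open>y\<close> out; \<open>n < vec.dim W\<close> leaves room for this
  choice.\<close>

lemma exists_rank_with_rsp:
  fixes U :: "('a::field^'k) set" and W :: "('a^'m) set"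
  assumes U: "vec.subspace U" and W: "vec.subspace W"
    and w: "w \<in> W" "w \<noteq> 0" and y: "y \<notin> vec.span {w}"
    and n: "1 \<le> n" "n \<le> vec.dim U" "n < vec.dim W"
  shows "\<exists>N \<in> tens U W. rank N = n \<and> w \<in> rsp N \<and> y \<notin> rsp N"
  using n
proof (induction n rule: nat_induct_at_least)
  case base
  have "\<not> U \<subseteq> {0}" using base(1) by (metis not_one_le_zero vec.dim_eq_0)
  then obtain u where u: "u \<in> U" "u \<noteq> 0" by blast
  have r: "rsp (outer u w) = vec.span {w}"
  proof
    show "rsp (outer u w) \<subseteq> vec.span {w}"
      by (auto simp: rsp_def vmult_simps vec.span_singleton)
    obtain i where i: "u $ i \<noteq> 0" using u(2) by (auto simp: vec_eq_iff)
    show "vec.span {w} \<subseteq> rsp (outer u w)"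
    proof
      fix x assume "x \<in> vec.span {w}"
      then obtain c where "x = c *s w" by (auto simp: vec.span_singleton)
      then have "x = ((c / u $ i) *s axis i 1) v* outer u w"
        using i by (simp add: vmult_simps vdot_simps)
      then show "x \<in> rsp (outer u w)" unfolding rsp_def by (metis rangeI)
    qed
  qed
  have "rank (outer u w) = 1" using w(2) by (simp add: rank_rsp r)
  moreover have "w \<in> rsp (outer u w)" unfolding r by (simp add: vec.span_base)
  ultimately show ?case using outer_in_tens[OF U W u(1) w(1)] y r by blast
next
  case (Suc n)
  then obtain N where N: "N \<in> tens U W" "rank N = n" "w \<in> rsp N" "y \<notin> rsp N" by auto
  have "vec.dim (csp N) < vec.dim U" using Suc N(2) by (simp add: rank_csp)
  then obtain u where u: "u \<in> U" "u \<notin> csp N" using vec.dim_subset leD by blast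
  obtain z where z: "z \<in> W" "z \<notin> vec.span (insert y (rsp N))"
    using exists_outside_span_insert[OF subspace_rsp[of N], where W=W] Suc N(2) rank_rsp
    by (metis Suc_eq_plus1)
  have zN: "z \<notin> rsp N" using z(2) vec.span_base by blast
  let ?N = "N + outer u z"
  have "y \<notin> rsp ?N"
    using not_in_span_insert_swap[OF subspace_rsp N(4) z(2)] rsp_add_outer_subset by blast
  moreover have "w \<in> rsp ?N" using rank_add_outer(2)[OF u(2) zN] N(3) by blast
  moreover have "?N \<in> tens U W"
    using matsp.subspace_add[OF subspace_tens[OF U W] N(1) outer_in_tens[OF U W u(1) z(1)]] .
  moreover have "rank ?N = Suc n"
  proof (rule antisym)
    have "rank ?N \<le> vec.dim (vec.span (insert z (rsp N)))"
      unfolding rank_rsp by (rule vec.dim_subset[OF rsp_add_outer_subset])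
    also have "\<dots> \<le> Suc n" using N(2) by (simp add: vec.dim_insert rank_rsp)
    finally show "rank ?N \<le> Suc n" .
    show "Suc n \<le> rank ?N" using rank_add_outer(1)[OF u(2) zN] N(2) by simp
  qed
  ultimately show ?case by blast
qed

text \<open>Two matrices of rank \<open>R\<close> with the same row space \<open>Z\<close> not containing \<open>y\<close>, differing by
  \<open>outer u w\<close>, force the corresponding rows \<open>b\<close> and \<open>b + y\<close> into \<open>Z\<close>. Working with such a pair
  avoids scaling arguments, which fail over the field with two elements.\<close>

lemma graph_row_in_span:
  fixes A :: "('a::{field,finite}^'m^'k) set"
  assumes A: "matsp.subspace A" and rk: "\<And>M. M \<in> A \<Longrightarrow> rank M \<le> R"
    and U: "vec.subspace U" "vec.dim U = R" "e \<notin> U" and W: "vec.subspace W" "R < vec.dim W"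
    and graph: "\<And>N. N \<in> tens U W \<Longrightarrow> \<exists>b. N + outer e b \<in> A"
    and u: "u \<in> U" "u \<noteq> 0" and w: "w \<in> W" "w \<noteq> 0" and y: "outer u w + outer e y \<in> A"
  shows "y \<in> vec.span {w}"
proof (rule ccontr)
  assume ny: "y \<notin> vec.span {w}"
  \<comment> \<open>If \<open>N\<close> already has rank \<open>R\<close>, a vector \<open>b\<close>
    outside its row space would push the rank of \<open>N + outer e b\<close> beyond
    \<open>R\<close>.\<close>
  have in_rsp: "b \<in> rsp N" if N: "N \<in> tens U W" "R \<le> rank N" "N + outer e b \<in> A" for N b
  proof (rule ccontr)
    assume b: "b \<notin> rsp N"
    have "e \<notin> csp N" using N(1) U(3) by (auto simp: tens_def)
    from rank_add_outer(1)[OF this b] rk[OF N(3)] N(2) show False by simp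
  qed
  obtain i where i: "u $ i \<noteq> 0" using u(2) by (auto simp: vec_eq_iff)
  let ?U = "velim i u ` U"
  have dU: "R = Suc (vec.dim ?U)" using dim_velim[OF U(1) u(1) i] U(2) by simp
  have u': "u \<notin> ?U" using i by (metis imageE velim_nth)
  have sub: "?U \<subseteq> U" using velim_in[OF U(1) u(1)] by blast
  show False
  proof (cases "R = 1")
    \<comment> \<open>Here \<open>R - 1\<close> is zero and no matrix of that rank has
      \<open>w\<close> in its row space; instead \<open>outer u w\<close> itself has rank
      \<open>R\<close>.\<close>
    case True
    have "outer u w \<noteq> 0" using u(2) w(2) outer_eq_0 by blast
    then have "R \<le> rank (outer u w)" using rank_pos[of "outer u w"] True by simp
    then have "y \<in> rsp (outer u w)" using in_rsp outer_in_tens[OF U(1) W(1) u(1) w(1)] y by blast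
    then show False using ny by (auto simp: rsp_def vmult_simps vec.span_singleton)
  next
    case False
    then have "1 \<le> R - 1" "R - 1 \<le> vec.dim ?U" "R - 1 < vec.dim W" using dU W(2) by linarith+
    \<comment> \<open>Keeping the columns of \<open>N\<close> in the eliminated space saves
      \<open>u\<close> for the last rank: \<open>N + outer u z\<close> and
      \<open>N + outer u (z + w)\<close> both reach rank \<open>R\<close>.\<close>
    then obtain N where N: "N \<in> tens ?U W" "rank N = R - 1" "w \<in> rsp N" "y \<notin> rsp N"
      using exists_rank_with_rsp[OF subspace_velim[OF U(1)] W(1) w ny, of "R - 1" i u] by blast
    have uN: "u \<notin> csp N" using N(1) u' by (auto simp: tens_def)
    obtain z where z: "z \<in> W" "z \<notin> vec.span (insert y (rsp N))"
      using exists_outside_span_insert[OF subspace_rsp[of N], where W=W and y=y] N(2) W(2) dU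
      by (auto simp: rank_rsp)
    have zN: "z \<notin> rsp N" using z(2) vec.span_base by blast
    have zwN: "z + w \<notin> rsp N"
      using zN vec.subspace_diff[OF subspace_rsp _ N(3), of "z + w"] by auto
    have NU: "N \<in> tens U W" using N(1) tens_mono[OF sub order_refl] by blast
    have N1: "N + outer u x \<in> tens U W" if "x \<in> W" for x
      using matsp.subspace_add[OF subspace_tens[OF U(1) W(1)] NU outer_in_tens[OF U(1) W(1) u(1) that]] .
    have zw: "z + w \<in> W" using z(1) w(1) W(1) vec.subspace_add by blast
    let ?Z = "vec.span (insert z (rsp N))"
    obtain b where b: "N + outer u z + outer e b \<in> A" using graph[OF N1[OF z(1)]] by blast
    have "b \<in> rsp (N + outer u z)"
      using in_rsp[OF N1[OF z(1)] _ b] rank_add_outer(1)[OF uN zN] N(2) dU by simp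
    then have bZ: "b \<in> ?Z" using rsp_add_outer_subset by blast
    have "N + outer u (z + w) + outer e (b + y)
        = (N + outer u z + outer e b) + (outer u w + outer e y)"
      by (simp add: outer_def vec_eq_iff algebra_simps)
    then have "N + outer u (z + w) + outer e (b + y) \<in> A"
      using matsp.subspace_add[OF A b y] by metis
    then have "b + y \<in> rsp (N + outer u (z + w))"
      using in_rsp[OF N1[OF zw]] rank_add_outer(1)[OF uN zwN] N(2) dU by simp
    then have "b + y \<in> vec.span (insert (z + w) (rsp N))" using rsp_add_outer_subset by blast
    \<comment> \<open>As \<open>w\<close> lies in the row space of \<open>N\<close>, adding it to
      \<open>z\<close> does not enlarge the span.\<close>
    moreover have "vec.span (insert (z + w) (rsp N)) \<subseteq> ?Z"
      by (rule vec.span_minimal)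
        (use N(3) in \<open>auto intro!: vec.span_add intro: vec.span_base\<close>)
    ultimately have "(b + y) - b \<in> ?Z" using bZ vec.span_diff by blast
    then show False using not_in_span_insert_swap[OF subspace_rsp N(4) z(2)] by simp
  qed
qed

text \<open>For fixed \<open>u\<close>, the trivial slice makes the row that completes
  \<open>outer u w\<close> unique, hence additive in \<open>w\<close>. Each \<open>w\<close> is sent
  to a multiple of itself, and this forces one common scalar.\<close>

lemma graph_scalar:
  fixes A :: "('a::{field,finite}^'m^'k) set"
  assumes A: "matsp.subspace A" and rk: "\<And>M. M \<in> A \<Longrightarrow> rank M \<le> R"
    and U: "vec.subspace U" "vec.dim U = R" "e \<notin> U" and W: "vec.subspace W" "R < vec.dim W"
    and graph: "\<And>N. N \<in> tens U W \<Longrightarrow> \<exists>b. N + outer e b \<in> A"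
    and slice: "slice e A \<subseteq> {0}" and u: "u \<in> U"
  shows "\<exists>c. \<forall>w\<in>W. outer (u + c *s e) w \<in> A"
proof (cases "u = 0")
  case True
  then have "outer (u + 0 *s e) w \<in> A" for w
    using matsp.subspace_0[OF A] by (simp add: outer_def zero_vec_def)
  then show ?thesis by blast
next
  case False
  have "\<exists>c. outer u w + outer e (c *s w) \<in> A" if w: "w \<in> W" for w
  proof (cases "w = 0")
    case True
    then show ?thesis using matsp.subspace_0[OF A] by (simp add: outer_0_right)
  next
    case w0: False
    obtain y where y: "outer u w + outer e y \<in> A"
      using graph[OF outer_in_tens[OF U(1) W(1) u w]] by blast
    have "y \<in> vec.span {w}"
      by (rule graph_row_in_span[OF A rk U W graph u False w w0 y])
    then show ?thesis using y by (auto simp: vec.span_singleton)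
  qed
  then obtain f where f: "\<And>w. w \<in> W \<Longrightarrow> outer u w + outer e (f w *s w) \<in> A" by metis
  have uniq: "y = y'" if "outer u w + outer e y \<in> A" "outer u w + outer e y' \<in> A" for w y y'
  proof -
    have "outer e (y - y') = (outer u w + outer e y) - (outer u w + outer e y')"
      by (simp add: outer_def vec_eq_iff algebra_simps)
    then have "y - y' \<in> slice e A" using matsp.subspace_diff[OF A that] by (simp add: slice_def)
    then show ?thesis using slice by auto
  qed
  have "\<not> W \<subseteq> {0}" using W(2) by (metis not_less_zero vec.dim_eq_0)
  then obtain x where x: "x \<in> W" "x \<noteq> 0" by blast
  \<comment> \<open>The scalar at the reference vector \<open>x\<close> serves for all
    \<open>w\<close>: multiples of \<open>x\<close> follow by scaling, the others by comparing
    coefficients of the independent \<open>w\<close> and \<open>x\<close> in the row assigned to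
    \<open>w + x\<close>.\<close>
  have "outer u w + outer e (f x *s w) \<in> A" if w: "w \<in> W" for w
  proof (cases "\<exists>c. w = c *s x")
    case True
    then obtain c where c: "w = c *s x" by blast
    have "outer u w + outer e (f x *s w) = mscale c (outer u x + outer e (f x *s x))"
      by (simp add: c outer_def vec_eq_iff mscale_def algebra_simps)
    then show ?thesis using matsp.subspace_scale[OF A f[OF x(1)]] by simp
  next
    case nw: False
    have wx: "w + x \<in> W" using w x(1) W(1) vec.subspace_add by blast
    have "outer u (w + x) + outer e (f w *s w + f x *s x)
        = (outer u w + outer e (f w *s w)) + (outer u x + outer e (f x *s x))"
      by (simp add: outer_def vec_eq_iff algebra_simps)
    then have "outer u (w + x) + outer e (f w *s w + f x *s x) \<in> A"
      using matsp.subspace_add[OF A f[OF w] f[OF x(1)]] by simp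
    then have eq: "f (w + x) *s (w + x) = f w *s w + f x *s x" using uniq f[OF wx] by blast
    then have eq': "(f (w + x) - f w) *s w = (f x - f (w + x)) *s x"
      by (simp add: vec_eq_iff algebra_simps)
    have "f (w + x) = f w"
    proof (rule ccontr)
      assume "f (w + x) \<noteq> f w"
      then have "w = (1 / (f (w + x) - f w)) *s ((f (w + x) - f w) *s w)"
        by (simp del: vector_sub_rdistrib vec.scale_left_diff_distrib)
      also have "\<dots> = ((f x - f (w + x)) / (f (w + x) - f w)) *s x" unfolding eq'
        by (simp del: vector_sub_rdistrib vec.scale_left_diff_distrib)
      finally show False using nw by blast
    qed
    moreover from this have "f x = f (w + x)" using eq' x(2) by simp
    ultimately show ?thesis using f[OF w] by simp
  qed
  moreover have "outer (u + f x *s e) w = outer u w + outer e (f x *s w)" for w :: "'a^'m"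
    by (simp add: outer_def vec_eq_iff algebra_simps)
  ultimately have "\<forall>w\<in>W. outer (u + f x *s e) w \<in> A" by simp
  then show ?thesis by blast
qed

text \<open>Induction on the dimension of \<open>U\<close> with \<open>R\<close> and
  \<open>W\<close> fixed. If some \<open>e\<close> of \<open>U\<close> outside the column space of a
  matrix \<open>M\<close> of maximal rank has trivial slice, the induction hypothesis describes the
  eliminated space and \<open>A\<close> is lifted back from it. Otherwise equality in the dimension
  count forces all these slices to be the row space of \<open>M\<close>.\<close>

theorem bounded_rank_classification:
  fixes A :: "('a::{field,finite}^'m^'k) set"
  assumes "matsp.subspace A" "A \<subseteq> tens U W" "vec.subspace U" "vec.subspace W"
    and "vec.dim U \<le> vec.dim W" "R \<le> vec.dim U" "\<And>M. M \<in> A \<Longrightarrow> rank M \<le> R"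
    and "matsp.dim A = vec.dim W * R"
  shows "(\<exists>U'. vec.subspace U' \<and> U' \<subseteq> U \<and> vec.dim U' = R \<and> A = tens U' W) \<or>
    (vec.dim U = vec.dim W \<and> (\<exists>W'. vec.subspace W' \<and> W' \<subseteq> W \<and> vec.dim W' = R \<and> A = tens U W'))"
  using assms
proof (induction "vec.dim U" arbitrary: U A rule: less_induct)
  case less
  note A = less(2,3) and U = less(4) and W = less(5) and rk = less(8) and dA = less(9)
  show ?case
  proof (cases "vec.dim U = R")
    case True
    have "A = tens U W"
      by (rule matsp.subspace_eq_of_dim) (use A U W dA True in \<open>auto simp: dim_tens\<close>)
    then show ?thesis using True U by blast
  next
    case False
    then have RU: "R < vec.dim U" using less(7) by simp
    obtain M where M: "M \<in> A" "\<And>N. N \<in> A \<Longrightarrow> rank N \<le> rank M"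
      using max_rank_element[OF matsp.subspace_0[OF A(1)]] by metis
    have "vec.dim (csp M) < vec.dim U" using RU rk[OF M(1)] by (simp add: rank_csp)
    then have "\<exists>e. e \<in> U \<and> e \<notin> csp M" using vec.dim_subset leD by blast
    show ?thesis
    proof (cases "\<exists>e \<in> U - csp M. slice e A \<subseteq> {0}")
      case True
      then obtain e where e: "e \<in> U" "e \<notin> csp M" and sl: "slice e A \<subseteq> {0}" by blast
      have "e \<noteq> 0" using e(2) vec.subspace_0[OF subspace_csp] by blast
      then obtain i where i: "e $ i \<noteq> 0" by (auto simp: vec_eq_iff)
      let ?V = "velim i e ` U" and ?P = "relim i e ` A"
      have dU: "vec.dim U = Suc (vec.dim ?V)" using dim_velim[OF U e(1) i] .
      have sV: "vec.subspace ?V" using subspace_velim[OF U] .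
      have linr: "module_hom mscale mscale (relim i e :: 'a^'m^'k \<Rightarrow> _)"
        unfolding module_hom_iff_linear by (rule linear_relim)
      have sP: "matsp.subspace ?P" by (rule module_hom.subspace_image[OF linr A(1)])
      have dP: "matsp.dim ?P = vec.dim W * R" using dim_slice[OF A(1) i] sl dA by simp
      have PV: "?P \<subseteq> tens ?V W" using A(2) relim_in_tens[OF _ W] by blast
      have rkP: "rank N \<le> R" if "N \<in> ?P" for N
        using that rk rank_relim_le[of i e] le_trans by blast
      \<comment> \<open>Since \<open>?V\<close> has smaller dimension than \<open>W\<close>, the
        second alternative of the induction hypothesis is excluded.\<close>
      have "vec.dim ?V < vec.dim U" "vec.dim ?V \<le> vec.dim W" "R \<le> vec.dim ?V"
        "vec.dim ?V \<noteq> vec.dim W"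
        using dU RU less(6) by linarith+
      from less(1)[OF this(1) sP PV sV W this(2,3) rkP dP] this(4)
      obtain T where T: "vec.subspace T" "T \<subseteq> ?V" "vec.dim T = R" "?P = tens T W"
        by blast
      have eT: "e \<notin> T" using T(2) i by (metis imageE subsetD velim_nth)
      have RW: "R < vec.dim W" using RU less(6) by simp
      have graph: "\<exists>b. N + outer e b \<in> A" if "N \<in> tens T W" for N
      proof -
        have "N \<in> relim i e ` A" using that T(4) by simp
        then obtain L where "L \<in> A" "N = relim i e L" by (rule imageE)
        then have "N + outer e ((1 / e $ i) *s L $ i) \<in> A" by (simp add: relim_def)
        then show ?thesis by blast
      qed
      \<comment> \<open>This will be the column space \<open>U'\<close>; the scalars from
        \<open>graph_scalar\<close> show that eliminating \<open>e\<close> maps it onto a space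
        containing \<open>T\<close>.\<close>
      define X where "X = {x \<in> U. \<forall>w\<in>W. outer x w \<in> A}"
      have X: "vec.subspace X"
      proof -
        have "outer (x + y) w = outer x w + outer y w" "outer (c *s x) w = mscale c (outer x w)"
          "outer (0 :: 'a^'k) w = 0" for x y :: "'a^'k" and w :: "'a^'m" and c
          by (auto simp: outer_def mscale_def vec_eq_iff algebra_simps)
        then show ?thesis using U A(1)
          by (auto simp: X_def vec.subspace_def matsp.subspace_def)
      qed
      have "T \<subseteq> velim i e ` X"
      proof
        fix u assume u: "u \<in> T"
        obtain c where c: "\<forall>w\<in>W. outer (u + c *s e) w \<in> A"
          using graph_scalar[OF A(1) rk T(1,3) eT W RW graph sl u] by blast
        have uU: "u \<in> U" using u T(2) velim_in[OF U e(1)] by blast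
        have "u $ i = 0" using u T(2) i by (metis imageE subsetD velim_nth)
        then have "velim i e (u + c *s e) = u" using i by (simp add: velim_def)
        moreover have "u + c *s e \<in> X"
          using c uU e(1) U by (simp add: X_def vec.subspace_add vec.subspace_scale)
        ultimately show "u \<in> velim i e ` X" by (metis imageI)
      qed
      then have RX: "R \<le> vec.dim X"
        using vec.dim_subset[of T "velim i e ` X"] vec.dim_image_le[OF linear_velim, of i e X] T(3)
        by linarith
      have XA: "tens X W \<subseteq> A"
        by (rule tens_subsetI[OF X W A(1)]) (auto simp: X_def)
      have "tens X W = A"
        by (rule matsp.subspace_eq_of_dim) (use XA X W A dA RX in \<open>auto simp: dim_tens\<close>)
      moreover from this have "vec.dim X = R"
        using dim_tens[OF X W] dA RW mult_cancel2[of "vec.dim X" "vec.dim W" R]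
        by (simp add: mult.commute del: vec.dim_eq_0)
      ultimately show ?thesis using X by (auto simp: X_def)
    next
      case False
      let ?S = "rsp M"
      \<comment> \<open>For every such \<open>e\<close> the count behind the dimension bound has to
        be tight, which forces equal dimensions of \<open>U\<close> and \<open>W\<close> and the
        largest possible slice.\<close>
      have main: "vec.dim U = vec.dim W \<and> vec.dim ?S = R \<and> slice e A = ?S"
        if e: "e \<in> U" "e \<notin> csp M" for e
      proof -
        have "e \<noteq> 0" using e(2) vec.subspace_0[OF subspace_csp] by blast
        then obtain i where i: "e $ i \<noteq> 0" by (auto simp: vec_eq_iff)
        obtain v where "v \<in> slice e A" "v \<noteq> 0" using False e by blast
        moreover from this obtain j where "v $ j \<noteq> 0" by (auto simp: vec_eq_iff)
        ultimately have v: "outer e v \<in> A" "v $ j \<noteq> 0" by (auto simp: slice_def)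
        have "v \<in> W"
          using slice_tens_subset[OF W A(2) \<open>e \<noteq> 0\<close>] v(1) by (auto simp: slice_def)
        let ?V = "velim i e ` U" and ?W = "velim j v ` W"
          and ?A = "(\<lambda>M. celim j v (relim i e M)) ` A"
        have dU: "vec.dim U = Suc (vec.dim ?V)" using dim_velim[OF U e(1) i] .
        have dW: "vec.dim W = Suc (vec.dim ?W)" using dim_velim[OF W \<open>v \<in> W\<close> v(2)] .
        have "\<forall>M\<in>A. rank M \<le> R" using rk by blast
        note B = eliminate_space[OF A U W i v this]
        have "1 \<le> R" using B(3)[OF imageI[OF M(1)]] by simp
        have "matsp.dim ?A \<le> vec.dim ?W * (R - 1)"
        proof (rule dim_le_of_rank_le[OF B(1,2) subspace_velim[OF U] subspace_velim[OF W]])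
          show "rank N \<le> R - 1" if "N \<in> ?A" for N using B(3)[OF that] by simp
        qed (use dU dW less(6) in auto)
        moreover have "matsp.dim A < vec.dim (slice e A) + vec.dim U + matsp.dim ?A"
          by (rule dim_le_slice[OF A U W e(1) i v(2)])
        ultimately have "vec.dim W * R < vec.dim (slice e A) + vec.dim U + vec.dim ?W * (R - 1)"
          using dA by linarith
        \<comment> \<open>Each term on the right is at most its partner on the left, so they agree
          in pairs.\<close>
        then have "R + vec.dim W \<le> vec.dim (slice e A) + vec.dim U"
          using \<open>1 \<le> R\<close> by (cases R) (auto simp: dW algebra_simps)
        moreover have sub: "slice e A \<subseteq> ?S" by (rule slice_subset_rsp[OF A(1) M e(2)])
        moreover have "vec.dim (slice e A) \<le> vec.dim ?S" by (rule vec.dim_subset[OF sub])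
        moreover have "vec.dim ?S \<le> R" using rk[OF M(1)] rank_rsp[of M] by simp
        ultimately have d: "vec.dim U = vec.dim W" "vec.dim ?S = R" "vec.dim (slice e A) = R"
          using less(6) by linarith+
        moreover have "slice e A = ?S"
          by (rule vec.subspace_dim_equal) (use subspace_slice[OF A(1)] sub d in auto)
        ultimately show ?thesis by simp
      qed
      obtain e where e: "e \<in> U" "e \<notin> csp M"
        using \<open>\<exists>e. e \<in> U \<and> e \<notin> csp M\<close> by blast
      have "outer u s \<in> A" if u: "u \<in> U" and s: "s \<in> ?S" for u s
      proof (cases "u \<in> csp M")
        case False
        then show ?thesis using main[OF u] s by (auto simp: slice_def)
      next
        case True
        \<comment> \<open>Directions inside the column space of \<open>M\<close> are differences of
          two outside it.\<close>
        have "u + e \<notin> csp M" using vec.subspace_diff[OF subspace_csp _ True, of "u + e"] e(2) by auto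
        moreover have "u + e \<in> U" using u e(1) U vec.subspace_add by blast
        ultimately have "outer (u + e) s \<in> A" "outer e s \<in> A"
          using main[OF _ \<open>u + e \<notin> csp M\<close>] main[OF e] s by (auto simp: slice_def)
        moreover have "outer u s = outer (u + e) s - outer e s"
          by (simp add: outer_def vec_eq_iff algebra_simps)
        ultimately show ?thesis using A(1) matsp.subspace_diff by metis
      qed
      then have sub: "tens U ?S \<subseteq> A" by (intro tens_subsetI[OF U subspace_rsp A(1)])
      have "tens U ?S = A"
        by (rule matsp.subspace_eq_of_dim) (use sub U A dA main[OF e] in \<open>auto simp: dim_tens\<close>)
      moreover have "?S \<subseteq> W" using M(1) A(2) by (auto simp: tens_def)
      ultimately show ?thesis using main[OF e] subspace_rsp by blast
    qed
  qed
qed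

section \<open>Optimal anticodes and generalized weights\<close>

lemma tens_UNIV [simp]: "tens UNIV UNIV = UNIV"
  by (simp add: tens_def)

lemma dim_UNIV_vec [simp]: "vec.dim (UNIV :: ('a::field^'n) set) = CARD('n)"
  by (simp add: card_cart_basis)

declare vec.dim_UNIV [simp del]

lemma rank_le_maxrk:
  fixes A :: "('a::{field,finite}^'m^'k) set"
  shows "M \<in> A \<Longrightarrow> rank M \<le> maxrk A"
  unfolding maxrk_def by (rule Max_ge) (auto simp: Setcompr_eq_image)

lemma maxrk_le:
  fixes A :: "('a::{field,finite}^'m^'k) set"
  assumes "M \<in> A" "\<And>N. N \<in> A \<Longrightarrow> rank N \<le> R"
  shows "maxrk A \<le> R"
  unfolding maxrk_def using assms by (subst Max_le_iff) (auto simp: Setcompr_eq_image)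

lemma anticode_bound:
  fixes A :: "('a::{field,finite}^'m^'k) set"
  assumes "CARD('k) \<le> CARD('m)" "matsp.subspace A"
  shows "ddim A \<le> CARD('m) * maxrk A"
  using dim_le_of_rank_le[of A UNIV UNIV "maxrk A"] assms rank_le_maxrk[of _ A]
  by (simp add: ddim_def dim_UNIV_vec)

text \<open>With the right dimension, an upper bound \<open>R\<close> on the ranks suffices: the
  anticode bound shows that \<open>R\<close> is attained.\<close>

lemma optimal_anticodeI:
  fixes A :: "('a::{field,finite}^'m^'k) set"
  assumes "CARD('k) \<le> CARD('m)" "matsp.subspace A" "\<And>M. M \<in> A \<Longrightarrow> rank M \<le> R"
    and "ddim A = CARD('m) * R"
  shows "optimal_anticode A" "maxrk A = R"
proof -
  have "maxrk A \<le> R" using maxrk_le[OF matsp.subspace_0[OF assms(2)]] assms(3) by blast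
  moreover have "R \<le> maxrk A" using anticode_bound[OF assms(1,2)] assms(4) by simp
  ultimately show "maxrk A = R" by simp
  then show "optimal_anticode A" using assms by (simp add: optimal_anticode_def delsarte_code_def)
qed

lemma tens_row_anticode:
  fixes U :: "('a::{field,finite}^'k) set"
  assumes "CARD('k) \<le> CARD('m)" "vec.subspace U"
  defines "A \<equiv> tens U (UNIV :: ('a^'m) set)"
  shows "optimal_anticode A" "maxrk A = vec.dim U"
proof -
  have s: "matsp.subspace A" using assms(2) by (simp add: A_def)
  have r: "rank M \<le> vec.dim U" if "M \<in> A" for M
    unfolding rank_csp by (rule vec.dim_subset) (use that in \<open>auto simp: A_def tens_def\<close>)
  have d: "ddim A = CARD('m) * vec.dim U"
    using assms(2) by (simp add: A_def ddim_def dim_tens dim_UNIV_vec)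
  show "optimal_anticode A" "maxrk A = vec.dim U"
    using optimal_anticodeI[OF assms(1) s r d] by auto
qed

text \<open>In the square case the dimension \<open>CARD('k) * vec.dim W\<close> is the one that
  optimality requires.\<close>

lemma tens_column_anticode:
  fixes W :: "('a::{field,finite}^'m) set"
  assumes "CARD('k) = CARD('m)" "vec.subspace W"
  defines "A \<equiv> tens (UNIV :: ('a^'k) set) W"
  shows "optimal_anticode A" "maxrk A = vec.dim W"
proof -
  have km: "CARD('k) \<le> CARD('m)" using assms(1) by simp
  have s: "matsp.subspace A" using assms(2) by (simp add: A_def)
  have r: "rank M \<le> vec.dim W" if "M \<in> A" for M
    unfolding rank_rsp by (rule vec.dim_subset) (use that in \<open>auto simp: A_def tens_def\<close>)
  have d: "ddim A = CARD('m) * vec.dim W"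
    using assms(1,2) by (simp add: A_def ddim_def dim_tens dim_UNIV_vec)
  show "optimal_anticode A" "maxrk A = vec.dim W"
    using optimal_anticodeI[OF km s r d] by auto
qed

lemma rank_le_CARD: "rank (M :: 'a::field^'m^'k) \<le> CARD('k)"
  unfolding rank_csp dim_UNIV_vec[where 'a='a, symmetric] by (rule vec.dim_subset) simp

text \<open>By the classification \<open>A\<close> is a tensor space; eliminate one direction of its
  factor \<open>U\<close> or \<open>W\<close>. Matrices of \<open>D\<close> with zero row
  \<open>i\<close> or zero column \<open>j\<close> survive unchanged, and that condition costs at
  most \<open>CARD('m)\<close> dimensions.\<close>

lemma exists_smaller_anticode:
  fixes A :: "('a::{field,finite}^'m^'k) set"
  assumes km: "CARD('k) \<le> CARD('m)" and A: "optimal_anticode A" "1 \<le> maxrk A"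
    and D: "matsp.subspace D" "D \<subseteq> A"
  shows "\<exists>A'. optimal_anticode A' \<and> maxrk A' + 1 = maxrk A \<and> ddim D \<le> ddim (A' \<inter> D) + CARD('m)"
proof -
  have sA: "matsp.subspace A" and dA: "ddim A = CARD('m) * maxrk A"
    using A(1) by (auto simp: optimal_anticode_def delsarte_code_def)
  have RK: "maxrk A \<le> CARD('k)"
    using maxrk_le[OF matsp.subspace_0[OF sA]] rank_le_CARD by blast
  have "(\<exists>U. vec.subspace U \<and> U \<subseteq> UNIV \<and> vec.dim U = maxrk A \<and> A = tens U UNIV) \<or>
    (vec.dim (UNIV :: ('a^'k) set) = vec.dim (UNIV :: ('a^'m) set) \<and>
      (\<exists>W. vec.subspace W \<and> W \<subseteq> UNIV \<and> vec.dim W = maxrk A \<and> A = tens UNIV W))"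
    by (rule bounded_rank_classification)
      (use sA dA RK km rank_le_maxrk in \<open>auto simp: dim_UNIV_vec ddim_def\<close>)
  then consider
    (row) U where "vec.subspace U" "vec.dim U = maxrk A" "A = tens U UNIV"
    | (column) W where "CARD('k) = CARD('m)" "vec.subspace W" "vec.dim W = maxrk A" "A = tens UNIV W"
    unfolding dim_UNIV_vec by blast
  then show ?thesis
  proof cases
    case row
    have "\<not> U \<subseteq> {0}" using row(2) A(2) by (metis not_one_le_zero vec.dim_eq_0)
    then obtain e i where e: "e \<in> U" "e $ i \<noteq> 0" by (force simp: vec_eq_iff)
    let ?A = "tens (velim i e ` U) (UNIV :: ('a^'m) set)"
    note opt = tens_row_anticode[where 'm='m, OF km subspace_velim[OF row(1), of i e]]
    have "{M \<in> D. M $ i = 0} \<subseteq> ?A \<inter> D"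
    proof
      fix M assume "M \<in> {M \<in> D. M $ i = 0}"
      then have M: "M \<in> D" "M $ i = 0" by auto
      have "relim i e M \<in> ?A" by (rule relim_in_tens) (use M(1) D(2) row(3) in auto)
      then show "M \<in> ?A \<inter> D" using M by (simp add: relim_def outer_0_right)
    qed
    then have "matsp.dim {M \<in> D. M $ i = 0} \<le> ddim (?A \<inter> D)"
      unfolding ddim_def by (intro matsp.dim_mono_finite) auto
    moreover have "vec.dim ((\<lambda>M. M $ i) ` D) \<le> CARD('m)"
      unfolding dim_UNIV_vec[where 'a='a, symmetric] by (rule vec.dim_subset) simp
    ultimately have "ddim D \<le> ddim (?A \<inter> D) + CARD('m)"
      using rank_nullity[OF linear_row_nth D(1), of i] by (simp add: ddim_def)
    then show ?thesis using opt dim_velim[OF row(1) e] row(2) by (intro exI[of _ ?A]) simp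
  next
    case column
    have "\<not> W \<subseteq> {0}" using column(3) A(2) by (metis not_one_le_zero vec.dim_eq_0)
    then obtain v j where v: "v \<in> W" "v $ j \<noteq> 0" by (force simp: vec_eq_iff)
    let ?A = "tens (UNIV :: ('a^'k) set) (velim j v ` W)"
    note opt = tens_column_anticode[where 'k='k, OF column(1) subspace_velim[OF column(2), of j v]]
    have "{M \<in> D. column j M = 0} \<subseteq> ?A \<inter> D"
    proof
      fix M assume "M \<in> {M \<in> D. column j M = 0}"
      then have M: "M \<in> D" "column j M = 0" by auto
      have "celim j v M \<in> ?A" by (rule celim_in_tens) (use M(1) D(2) column(4) in auto)
      moreover have "celim j v M = M"
        using M(2) by (simp add: celim_def velim_def column_def vec_eq_iff)
      ultimately show "M \<in> ?A \<inter> D" using M by simp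
    qed
    then have "matsp.dim {M \<in> D. column j M = 0} \<le> ddim (?A \<inter> D)"
      unfolding ddim_def by (intro matsp.dim_mono_finite) auto
    \<comment> \<open>Columns have length \<open>CARD('k)\<close>, which equals
      \<open>CARD('m)\<close> in this case.\<close>
    moreover have "vec.dim (column j ` D) \<le> CARD('m)"
      unfolding column(1)[symmetric] dim_UNIV_vec[where 'a='a, symmetric]
      by (rule vec.dim_subset) simp
    ultimately have "ddim D \<le> ddim (?A \<inter> D) + CARD('m)"
      using rank_nullity[OF linear_column D(1), of j] by (simp add: ddim_def)
    then show ?thesis using opt dim_velim[OF column(2) v] column(3) by (intro exI[of _ ?A]) simp
  qed
qed

lemma optimal_anticode_UNIV:
  assumes "CARD('k) \<le> CARD('m)"
  shows "optimal_anticode (UNIV :: ('a::{field,finite}^'m^'k) set)"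
    "maxrk (UNIV :: ('a^'m^'k) set) = CARD('k)"
  using tens_row_anticode[where 'm='m, OF assms vec.subspace_UNIV[where 'a='a]]
  by simp_all

text \<open>Start from the full matrix space and lower the rank \<open>s\<close> times, always
  relative to the intersection with \<open>C\<close>; each step costs at most
  \<open>CARD('m)\<close> dimensions.\<close>

lemma exists_anticode_large_inter:
  fixes C :: "('a::{field,finite}^'m^'k) set"
  assumes km: "CARD('k) \<le> CARD('m)" and C: "matsp.subspace C" and s: "s \<le> CARD('k)"
  shows "\<exists>A. optimal_anticode A \<and> maxrk A + s = CARD('k) \<and> ddim C \<le> ddim (A \<inter> C) + CARD('m) * s"
  using s
proof (induction s)
  case 0
  then show ?case using optimal_anticode_UNIV[OF km, where 'a='a] by (intro exI[of _ UNIV]) simp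
next
  case (Suc s)
  then obtain A where A: "optimal_anticode A" "maxrk A + s = CARD('k)"
    "ddim C \<le> ddim (A \<inter> C) + CARD('m) * s" by auto
  have D: "matsp.subspace (A \<inter> C)"
    using A(1) C by (simp add: optimal_anticode_def delsarte_code_def matsp.subspace_inter)
  have "1 \<le> maxrk A" using A(2) Suc.prems by simp
  from exists_smaller_anticode[OF km A(1) this D Int_lower1]
  obtain A' where A': "optimal_anticode A'" "maxrk A' + 1 = maxrk A"
    "ddim (A \<inter> C) \<le> ddim (A' \<inter> (A \<inter> C)) + CARD('m)" by blast
  have "ddim (A' \<inter> (A \<inter> C)) \<le> ddim (A' \<inter> C)"
    unfolding ddim_def by (rule matsp.dim_mono_finite) auto
  then show ?case using A A' by (intro exI[of _ A']) simp
qed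

section \<open>Generalized weights as minima of maximal ranks\<close>

lemma delsarte_weight_le:
  fixes C :: "('a::{field,finite}^'m^'k) set"
  assumes "optimal_anticode A" "r \<le> ddim (A \<inter> C)"
  shows "delsarte_weight r C \<le> real (maxrk A)"
proof -
  have "Min {ddim A | A. optimal_anticode A \<and> ddim (A \<inter> C) \<ge> r} \<le> ddim A"
    by (rule Min_le) (use assms in \<open>auto simp: Setcompr_eq_image\<close>)
  \<comment> \<open>Optimality makes the dimension a multiple of \<open>CARD('m)\<close>, so the
    factor in the weight leaves the maximal rank.\<close>
  also have "ddim A = CARD('m) * maxrk A" using assms by (simp add: optimal_anticode_def)
  finally have "real (Min {ddim A | A. optimal_anticode A \<and> ddim (A \<inter> C) \<ge> r})
      \<le> real CARD('m) * real (maxrk A)"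
    unfolding of_nat_mult[symmetric] of_nat_le_iff .
  then show ?thesis by (simp add: delsarte_weight_def field_simps)
qed

lemma delsarte_weight_attained:
  fixes C :: "('a::{field,finite}^'m^'k) set"
  assumes "CARD('k) \<le> CARD('m)" "r \<le> ddim C"
  obtains A where "optimal_anticode A" "r \<le> ddim (A \<inter> C)" "delsarte_weight r C = real (maxrk A)"
proof -
  let ?S = "{ddim A | A. optimal_anticode A \<and> ddim (A \<inter> C) \<ge> r}"
  have "Min ?S \<in> ?S"
  proof (rule Min_in)
    show "finite ?S" by (simp add: Setcompr_eq_image)
    \<comment> \<open>The full matrix space is a candidate, so the minimum is over a nonempty
      set.\<close>
    have "ddim (UNIV :: ('a^'m^'k) set) \<in> ?S"
      using optimal_anticode_UNIV[OF assms(1), where 'a='a] assms(2)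
      by (intro CollectI exI[of _ UNIV]) simp
    then show "?S \<noteq> {}" by blast
  qed
  then obtain A where A: "Min ?S = ddim A" "optimal_anticode A" "r \<le> ddim (A \<inter> C)" by blast
  moreover from this have "ddim A = CARD('m) * maxrk A" by (simp add: optimal_anticode_def)
  ultimately show thesis using that[of A] by (simp add: delsarte_weight_def)
qed

text \<open>Upper bound: take the matrices with columns in the column space of a codeword
  \<open>N\<close> of least positive rank. Lower bound: an anticode meeting \<open>C\<close>
  nontrivially contains a nonzero codeword, whose rank its maximal rank dominates.\<close>

lemma delsarte_weight_1:
  fixes C :: "('a::{field,finite}^'m^'k) set"
  assumes km: "CARD('k) \<le> CARD('m)" and C: "matsp.subspace C" "C \<noteq> {0}"
  shows "delsarte_weight 1 C = real (minrk C)"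
proof -
  let ?S = "{rank M | M. M \<in> C \<and> rank M > 0}"
  have fin: "finite ?S" by (simp add: Setcompr_eq_image)
  have pos: "1 \<le> ddim D" if "matsp.subspace D" "M \<in> D" "M \<noteq> 0" for D and M :: "'a^'m^'k"
  proof (rule ccontr)
    assume "\<not> 1 \<le> ddim D"
    then have "card D = 1" using matsp.card_subspace[OF _ that(1)] by (simp add: ddim_def)
    moreover have "0 \<in> D" using that(1) matsp.subspace_0 by blast
    ultimately show False using that(2,3) by (metis card_1_singletonE singletonD)
  qed
  obtain M where M: "M \<in> C" "M \<noteq> 0" using C matsp.subspace_0 by blast
  then have "rank M \<in> ?S" using rank_pos[of M] by blast
  then have "minrk C \<in> ?S" unfolding minrk_def using fin by (intro Min_in) auto
  then obtain N where N: "minrk C = rank N" "N \<in> C" "0 < rank N" by blast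
  have "optimal_anticode (tens (csp N) (UNIV :: ('a^'m) set))" "maxrk (tens (csp N) (UNIV :: ('a^'m) set)) = rank N"
    using tens_row_anticode[where 'm='m, OF km subspace_csp[of N]] by (simp_all add: rank_csp)
  moreover have "1 \<le> ddim (tens (csp N) (UNIV :: ('a^'m) set) \<inter> C)"
  proof (rule pos)
    show "matsp.subspace (tens (csp N) UNIV \<inter> C)"
      by (intro matsp.subspace_inter subspace_tens C(1)) auto
    show "N \<in> tens (csp N) UNIV \<inter> C" using N(2) by (simp add: tens_def)
    show "N \<noteq> 0" using N(3) rank_pos by blast
  qed
  ultimately have "delsarte_weight 1 C \<le> real (minrk C)"
    using delsarte_weight_le[of "tens (csp N) UNIV" 1 C] N(1) by simp
  moreover have "real (minrk C) \<le> delsarte_weight 1 C"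
  proof -
    obtain A where A: "optimal_anticode A" "1 \<le> ddim (A \<inter> C)" "delsarte_weight 1 C = real (maxrk A)"
      using delsarte_weight_attained[OF km pos[OF C(1) M]] by metis
    have "\<not> A \<inter> C \<subseteq> {0}"
    proof
      assume "A \<inter> C \<subseteq> {0}"
      then have "ddim (A \<inter> C) \<le> ddim {0 :: 'a^'m^'k}"
        unfolding ddim_def by (intro matsp.dim_mono_finite) auto
      then show False using A(2) by (simp add: ddim_def)
    qed
    then obtain L where L: "L \<in> A" "L \<in> C" "L \<noteq> 0" by blast
    then have "minrk C \<le> rank L"
      unfolding minrk_def using fin rank_pos[of L] by (intro Min_le) auto
    then show ?thesis using rank_le_maxrk[OF L(1)] A(3) by simp
  qed
  ultimately show ?thesis by simp
qed

theorem theorem6p2: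
  fixes C :: "('a::{field,finite}^'m::finite^'k::finite) set"
    and t :: nat
  assumes km: "CARD('k) \<le> CARD('m)"
    and code: "delsarte_code C"
    and nonzero: "C \<noteq> {0}"
    and tdim: "t = ddim C"
  shows "delsarte_weight 1 C = real (minrk C)
    \<and> delsarte_weight t C \<le> real CARD('k)
    \<and> (\<forall>r. 1 \<le> r \<and> r \<le> t - 1 \<longrightarrow> delsarte_weight r C \<le> delsarte_weight (r + 1) C)
    \<and> (\<forall>r. 1 \<le> r \<and> r + CARD('m) \<le> t \<longrightarrow> delsarte_weight r C < delsarte_weight (r + CARD('m)) C)
    \<and> (\<forall>r. 1 \<le> r \<and> r \<le> t \<longrightarrow>
          delsarte_weight r C \<le> real CARD('k) - real ((t - r) div CARD('m)))
    \<and> (\<forall>r. 1 \<le> r \<and> r \<le> t \<longrightarrow>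
          delsarte_weight r C \<ge> real_of_int \<lceil>real r / real CARD('m)\<rceil>)"
proof (intro conjI allI impI)
  have C: "matsp.subspace C" using code by (simp add: delsarte_code_def)
  show "delsarte_weight 1 C = real (minrk C)" using delsarte_weight_1[OF km C nonzero] .
  \<comment> \<open>Stated for all \<open>r \<le> t\<close>; the instance \<open>r = t\<close>,
    where the quotient is zero, gives the second part.\<close>
  have five: "delsarte_weight r C \<le> real CARD('k) - real ((t - r) div CARD('m))" if "r \<le> t" for r
  proof -
    let ?s = "(t - r) div CARD('m)"
    \<comment> \<open>This ensures \<open>?s \<le> CARD('k)\<close>, the number of rank steps
      available from the full space.\<close>
    have "t \<le> CARD('m) * CARD('k)"
    proof -
      have "t \<le> ddim (UNIV :: ('a^'m^'k) set)"
        unfolding tdim ddim_def by (rule matsp.dim_mono_finite) auto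
      then show ?thesis
        using optimal_anticode_UNIV[OF km, where 'a='a] by (simp add: optimal_anticode_def)
    qed
    then have "?s \<le> CARD('m) * CARD('k) div CARD('m)" by (intro div_le_mono) simp
    then have "?s \<le> CARD('k)" by simp
    then obtain A where A: "optimal_anticode A" "maxrk A + ?s = CARD('k)"
      "ddim C \<le> ddim (A \<inter> C) + CARD('m) * ?s"
      using exists_anticode_large_inter[OF km C] by blast
    have "CARD('m) * ?s \<le> t - r" by simp
    then have "r \<le> ddim (A \<inter> C)" using A(3) that tdim by linarith
    from delsarte_weight_le[OF A(1) this] A(2) show ?thesis by linarith
  qed
  then show "delsarte_weight r C \<le> real CARD('k) - real ((t - r) div CARD('m))"
    if "1 \<le> r \<and> r \<le> t" for r using that by blast
  show "delsarte_weight t C \<le> real CARD('k)" using five[of t] by simp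
  show "delsarte_weight r C \<le> delsarte_weight (r + 1) C" if r: "1 \<le> r \<and> r \<le> t - 1" for r
  proof -
    have "r + 1 \<le> ddim C" using r tdim by linarith
    then obtain A where A: "optimal_anticode A" "r + 1 \<le> ddim (A \<inter> C)"
      "delsarte_weight (r + 1) C = real (maxrk A)"
      by (rule delsarte_weight_attained[OF km])
    then show ?thesis using delsarte_weight_le[OF A(1), of r C] by simp
  qed
  show "delsarte_weight r C < delsarte_weight (r + CARD('m)) C" if r: "1 \<le> r \<and> r + CARD('m) \<le> t" for r
  proof -
    have "r + CARD('m) \<le> ddim C" using r tdim by simp
    then obtain A where A: "optimal_anticode A" "r + CARD('m) \<le> ddim (A \<inter> C)"
      "delsarte_weight (r + CARD('m)) C = real (maxrk A)"
      by (rule delsarte_weight_attained[OF km])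
    have D: "matsp.subspace (A \<inter> C)"
      using A(1) C by (simp add: optimal_anticode_def delsarte_code_def matsp.subspace_inter)
    have "ddim (A \<inter> C) \<le> ddim A" unfolding ddim_def by (rule matsp.dim_mono_finite) auto
    then have "0 < ddim A" using A(2) r by linarith
    then have "0 < CARD('m) * maxrk A" using A(1) by (simp add: optimal_anticode_def)
    then have "1 \<le> maxrk A" by (cases "maxrk A") auto
    \<comment> \<open>One rank step costs at most \<open>CARD('m)\<close> dimensions of the
      intersection, which leaves at least \<open>r\<close>.\<close>
    from exists_smaller_anticode[OF km A(1) this D Int_lower1]
    obtain A' where A': "optimal_anticode A'" "maxrk A' + 1 = maxrk A"
      "ddim (A \<inter> C) \<le> ddim (A' \<inter> (A \<inter> C)) + CARD('m)" by blast
    have "ddim (A' \<inter> (A \<inter> C)) \<le> ddim (A' \<inter> C)"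
      unfolding ddim_def by (rule matsp.dim_mono_finite) auto
    then have "r \<le> ddim (A' \<inter> C)" using A(2) A'(3) by simp
    from delsarte_weight_le[OF A'(1) this] show ?thesis using A(3) A'(2) by simp
  qed
  show "delsarte_weight r C \<ge> real_of_int \<lceil>real r / real CARD('m)\<rceil>" if r: "1 \<le> r \<and> r \<le> t" for r
  proof -
    have "r \<le> ddim C" using r tdim by simp
    then obtain A where A: "optimal_anticode A" "r \<le> ddim (A \<inter> C)"
      "delsarte_weight r C = real (maxrk A)"
      by (rule delsarte_weight_attained[OF km])
    have "ddim (A \<inter> C) \<le> ddim A" unfolding ddim_def by (rule matsp.dim_mono_finite) auto
    then have "r \<le> CARD('m) * maxrk A" using A(1,2) by (simp add: optimal_anticode_def)
    then have "real r \<le> real CARD('m) * real (maxrk A)"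
      unfolding of_nat_mult[symmetric] of_nat_le_iff .
    then have "real r / real CARD('m) \<le> of_int (int (maxrk A))" by (simp add: field_simps)
    then have "\<lceil>real r / real CARD('m)\<rceil> \<le> int (maxrk A)" by (rule ceiling_le)
    then show ?thesis using A(3) by linarith
  qed
qed

end
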